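(* Let $\mathbf{k}$ be a commutative unital ring, $\lambda\in\mathbf{k}$, let $(A,m,1)$ be a unital associative $\mathbf{k}$-algebra and $r\in A\otimes A$. If $r$ is a solution of the associative Yang-Baxter equation of weight $\lambda$ in $A$, then $(A,m,1,\Delta_r)$ is an infinitesimal unitary bialgebra of weight $\lambda$, where $\Delta_r:A\to A\otimes A$ is given by $\Delta_r(a)=a\cdot r-r\cdot a-\lambda(a\otimes 1)$.
   Context: Tensor products are over $\mathbf{k}$. $A\otimes A$ is an $A$-bimodule via $a\cdot(b\otimes c)=ab\otimes c$ and $(b\otimes c)\cdot a=b\otimes ca$. For $r=\sum_i u_i\otimes v_i\in A\otimes A$, set $r_{12}=\sum_i u_i\otimes v_i\otimes 1$, $r_{13}=\sum_i u_i\otimes 1\otimes v_i$, $r_{23}=\sum_i 1\otimes u_i\otimes v_i$ in the tensor product algebra $A\otimes A\otimes A$. The element $r$ is a solution of the associative Yang-Baxter equation of weight $\lambda$ in $A$ if $r_{13}r_{12}-r_{12}r_{23}+r_{23}r_{13}=\lambda r_{13}$. An infinitesimal unitary bialgebra of weight $\lambda$ is a quadruple $(A,m,1,\Delta)$ where $(A,m,1)$ is a unital associative $\mathbf{k}$-algebra and $\Delta:A\to A\otimes A$ is a coassociative linear map (no counit is required) such that $\Delta(ab)=a\cdot\Delta(b)+\Delta(a)\cdot b+\lambda(a\otimes b)$ for all $a,b\in A$. *)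

theory Defs
  imports HOL.Hull "HOL-Algebra.Module" "HOL-Algebra.QuotRing"
begin

section \<open>Unital associative algebras and linear maps\<close>

text \<open>The locale \<^locale>\<open>algebra\<close> of the library is for commutative algebras; the following
  one is not. As everywhere in HOL-Algebra, the zero ring is allowed.\<close>

locale unital_algebra = module R A + A?: ring A for R (structure) and A (structure) +
  assumes smult_mult_left:
      "\<lbrakk>c \<in> carrier R; x \<in> carrier A; y \<in> carrier A\<rbrakk> \<Longrightarrow>
        (c \<odot>\<^bsub>A\<^esub> x) \<otimes>\<^bsub>A\<^esub> y = c \<odot>\<^bsub>A\<^esub> (x \<otimes>\<^bsub>A\<^esub> y)"
    and smult_mult_right:
      "\<lbrakk>c \<in> carrier R; x \<in> carrier A; y \<in> carrier A\<rbrakk> \<Longrightarrow>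
        x \<otimes>\<^bsub>A\<^esub> (c \<odot>\<^bsub>A\<^esub> y) = c \<odot>\<^bsub>A\<^esub> (x \<otimes>\<^bsub>A\<^esub> y)"

definition linear_maps ::
  "('k, 'r) ring_scheme \<Rightarrow> ('k, 'a, 'm) module_scheme \<Rightarrow> ('k, 'b, 'n) module_scheme \<Rightarrow> ('a \<Rightarrow> 'b) set"
  where "linear_maps R M N =
    {h \<in> carrier M \<rightarrow> carrier N.
      (\<forall>x\<in>carrier M. \<forall>y\<in>carrier M. h (x \<oplus>\<^bsub>M\<^esub> y) = h x \<oplus>\<^bsub>N\<^esub> h y) \<and>
      (\<forall>c\<in>carrier R. \<forall>x\<in>carrier M. h (c \<odot>\<^bsub>M\<^esub> x) = c \<odot>\<^bsub>N\<^esub> h x)}"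

definition bilinear_maps ::
  "('k, 'r) ring_scheme \<Rightarrow> ('k, 'a, 'm) module_scheme \<Rightarrow> ('k, 'b, 'n) module_scheme \<Rightarrow>
    ('k, 'c, 'p) module_scheme \<Rightarrow> ('a \<Rightarrow> 'b \<Rightarrow> 'c) set"
  where "bilinear_maps R M N P =
    {\<phi>. (\<forall>m\<in>carrier M. \<phi> m \<in> linear_maps R N P) \<and>
        (\<forall>n\<in>carrier N. (\<lambda>m. \<phi> m n) \<in> linear_maps R M P)}"


section \<open>Tensor products\<close>

text \<open>The records below live in type \<^type>\<open>module_ext\<close>, which also has fields for a
  multiplication and its unit; these are left unspecified for a mere module.\<close>

definition free_module :: "('k, 'r) ring_scheme \<Rightarrow> 'x set \<Rightarrow> ('k, 'x \<Rightarrow> 'k) module"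
  where "free_module R X =
    \<lparr>carrier = {f. f \<in> X \<rightarrow> carrier R \<and> (\<forall>x. x \<notin> X \<longrightarrow> f x = \<zero>\<^bsub>R\<^esub>) \<and> finite {x. f x \<noteq> \<zero>\<^bsub>R\<^esub>}},
     mult = undefined, one = undefined,
     zero = (\<lambda>x. \<zero>\<^bsub>R\<^esub>), add = (\<lambda>f g x. f x \<oplus>\<^bsub>R\<^esub> g x),
     smult = (\<lambda>c f x. c \<otimes>\<^bsub>R\<^esub> f x)\<rparr>"

definition free_gen :: "('k, 'r) ring_scheme \<Rightarrow> 'x \<Rightarrow> ('x \<Rightarrow> 'k)"
  where "free_gen R x = (\<lambda>y. if y = x then \<one>\<^bsub>R\<^esub> else \<zero>\<^bsub>R\<^esub>)"

definition free_lift ::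
  "('k, 'r) ring_scheme \<Rightarrow> ('k, 'c, 'p) module_scheme \<Rightarrow> ('x \<Rightarrow> 'c) \<Rightarrow> ('x \<Rightarrow> 'k) \<Rightarrow> 'c"
  where "free_lift R P \<phi> f = (\<Oplus>\<^bsub>P\<^esub>x\<in>{x. f x \<noteq> \<zero>\<^bsub>R\<^esub>}. f x \<odot>\<^bsub>P\<^esub> \<phi> x)"

definition quotient_module ::
  "('k, 'a, 'm) module_scheme \<Rightarrow> 'a set \<Rightarrow> ('k, 'a set) module"
  where "quotient_module M H =
    \<lparr>carrier = a_rcosets\<^bsub>M\<^esub> H, mult = undefined, one = undefined,
     zero = H, add = set_add M,
     smult = (\<lambda>c X. \<Union>x\<in>X. H +>\<^bsub>M\<^esub> (c \<odot>\<^bsub>M\<^esub> x))\<rparr>"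

definition tensor_relations ::
  "('k, 'r) ring_scheme \<Rightarrow> ('k, 'a, 'm) module_scheme \<Rightarrow> ('k, 'b, 'n) module_scheme \<Rightarrow>
    ('a \<times> 'b \<Rightarrow> 'k) set"
  where "tensor_relations R M N =
    (let F = free_module R (carrier M \<times> carrier N); e = free_gen R in
      {e (m \<oplus>\<^bsub>M\<^esub> m', n) \<ominus>\<^bsub>F\<^esub> (e (m, n) \<oplus>\<^bsub>F\<^esub> e (m', n)) | m m' n.
          m \<in> carrier M \<and> m' \<in> carrier M \<and> n \<in> carrier N} \<union>
      {e (m, n \<oplus>\<^bsub>N\<^esub> n') \<ominus>\<^bsub>F\<^esub> (e (m, n) \<oplus>\<^bsub>F\<^esub> e (m, n')) | m n n'.
          m \<in> carrier M \<and> n \<in> carrier N \<and> n' \<in> carrier N} \<union>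
      {e (c \<odot>\<^bsub>M\<^esub> m, n) \<ominus>\<^bsub>F\<^esub> c \<odot>\<^bsub>F\<^esub> e (m, n) | c m n.
          c \<in> carrier R \<and> m \<in> carrier M \<and> n \<in> carrier N} \<union>
      {e (m, c \<odot>\<^bsub>N\<^esub> n) \<ominus>\<^bsub>F\<^esub> c \<odot>\<^bsub>F\<^esub> e (m, n) | c m n.
          c \<in> carrier R \<and> m \<in> carrier M \<and> n \<in> carrier N})"

definition tensor_kernel ::
  "('k, 'r) ring_scheme \<Rightarrow> ('k, 'a, 'm) module_scheme \<Rightarrow> ('k, 'b, 'n) module_scheme \<Rightarrow>
    ('a \<times> 'b \<Rightarrow> 'k) set"
  where "tensor_kernel R M N =
    (\<lambda>H. submodule H R (free_module R (carrier M \<times> carrier N))) hull tensor_relations R M N"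

type_synonym ('k, 'a, 'b) tensor = "('a \<times> 'b \<Rightarrow> 'k) set"

definition tensor_module ::
  "('k, 'r) ring_scheme \<Rightarrow> ('k, 'a, 'm) module_scheme \<Rightarrow> ('k, 'b, 'n) module_scheme \<Rightarrow>
    ('k, ('k, 'a, 'b) tensor) module"
  where "tensor_module R M N =
    quotient_module (free_module R (carrier M \<times> carrier N)) (tensor_kernel R M N)"

definition pure_tensor ::
  "('k, 'r) ring_scheme \<Rightarrow> ('k, 'a, 'm) module_scheme \<Rightarrow> ('k, 'b, 'n) module_scheme \<Rightarrow>
    'a \<Rightarrow> 'b \<Rightarrow> ('k, 'a, 'b) tensor"
  where "pure_tensor R M N m n =
    tensor_kernel R M N +>\<^bsub>free_module R (carrier M \<times> carrier N)\<^esub> free_gen R (m, n)"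

text \<open>The linear map induced by a bilinear map \<open>\<phi>\<close>. It is constant on each coset, hence
  \<^const>\<open>the_elem\<close>; see \<open>tensor_lift_pure\<close> and \<open>tensor_lift_unique\<close> below.\<close>

definition tensor_lift ::
  "('k, 'r) ring_scheme \<Rightarrow> ('k, 'c, 'p) module_scheme \<Rightarrow> ('a \<Rightarrow> 'b \<Rightarrow> 'c) \<Rightarrow>
    ('k, 'a, 'b) tensor \<Rightarrow> 'c"
  where "tensor_lift R P \<phi> X = the_elem (free_lift R P (\<lambda>(m, n). \<phi> m n) ` X)"

subsection \<open>The universal property\<close>

lemma free_module_module:
  fixes R :: "('k, 'r) ring_scheme" and X :: "'x set"
  assumes "cring R" shows "module R (free_module R X)"
proof -
  interpret R: cring R by fact
  have fin: "finite {x. (f x \<oplus>\<^bsub>R\<^esub> g x) \<noteq> \<zero>\<^bsub>R\<^esub>}"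
    if "finite {x. f x \<noteq> \<zero>\<^bsub>R\<^esub>}" "finite {x. g x \<noteq> \<zero>\<^bsub>R\<^esub>}" for f g :: "'x \<Rightarrow> 'k"
    by (rule finite_subset[OF _ finite_UnI[OF that]]) auto
  have fins: "finite {x. (c \<otimes>\<^bsub>R\<^esub> f x) \<noteq> \<zero>\<^bsub>R\<^esub>}"
    if "c \<in> carrier R" "finite {x. f x \<noteq> \<zero>\<^bsub>R\<^esub>}" for c and f :: "'x \<Rightarrow> 'k"
    by (rule finite_subset[OF _ that(2)]) (use that in auto)
  let ?F = "free_module R X"
  have mem: "f \<in> carrier ?F \<longleftrightarrow>
      (\<forall>x. f x \<in> carrier R) \<and> (\<forall>x. x \<notin> X \<longrightarrow> f x = \<zero>\<^bsub>R\<^esub>) \<and> finite {x. f x \<noteq> \<zero>\<^bsub>R\<^esub>}" for f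
  proof
    assume f: "f \<in> carrier ?F"
    then have "f x \<in> carrier R" for x by (cases "x \<in> X") (auto simp: free_module_def)
    with f show "(\<forall>x. f x \<in> carrier R) \<and> (\<forall>x. x \<notin> X \<longrightarrow> f x = \<zero>\<^bsub>R\<^esub>) \<and> finite {x. f x \<noteq> \<zero>\<^bsub>R\<^esub>}"
      by (simp add: free_module_def)
  qed (simp add: free_module_def)
  have ops: "f \<oplus>\<^bsub>?F\<^esub> g = (\<lambda>x. f x \<oplus>\<^bsub>R\<^esub> g x)" "c \<odot>\<^bsub>?F\<^esub> f = (\<lambda>x. c \<otimes>\<^bsub>R\<^esub> f x)" "\<zero>\<^bsub>?F\<^esub> = (\<lambda>x. \<zero>\<^bsub>R\<^esub>)"
    for f g c by (simp_all add: free_module_def)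
  show ?thesis
  proof (rule moduleI[OF assms])
    show "abelian_group ?F"
    proof (rule abelian_groupI)
      show "\<exists>y\<in>carrier ?F. y \<oplus>\<^bsub>?F\<^esub> f = \<zero>\<^bsub>?F\<^esub>" if f: "f \<in> carrier ?F" for f
      proof -
        have "{x. (\<ominus>\<^bsub>R\<^esub> f x) \<noteq> \<zero>\<^bsub>R\<^esub>} \<subseteq> {x. f x \<noteq> \<zero>\<^bsub>R\<^esub>}" by auto
        then have "finite {x. (\<ominus>\<^bsub>R\<^esub> f x) \<noteq> \<zero>\<^bsub>R\<^esub>}"
          by (rule finite_subset) (use f in \<open>simp add: mem\<close>)
        then show ?thesis
          using f by (intro bexI[of _ "\<lambda>x. \<ominus>\<^bsub>R\<^esub> f x"]) (simp_all add: mem ops R.l_neg)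
      qed
    qed (auto simp: mem ops fin R.a_ac)
  qed (auto simp: mem ops fins R.l_distr R.r_distr R.m_assoc)
qed

lemma free_gen_closed:
  assumes "cring R" "x \<in> X" shows "free_gen R x \<in> carrier (free_module R X)"
proof -
  interpret R: cring R by fact
  have "{y. free_gen R x y \<noteq> \<zero>\<^bsub>R\<^esub>} \<subseteq> {x}" by (auto simp: free_gen_def)
  from finite_subset[OF this] show ?thesis
    using assms by (auto simp: free_module_def free_gen_def)
qed

lemma submodule_Inter:
  assumes "module R M" "\<H> \<noteq> {}" "\<And>H. H \<in> \<H> \<Longrightarrow> submodule H R M"
  shows "submodule (\<Inter>\<H>) R M"
proof -
  interpret M: module R M by fact
  note E = M.submoduleE[OF assms(3)]
  show ?thesis
  proof (rule M.submoduleI)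
    show "\<zero>\<^bsub>M\<^esub> \<in> \<Inter>\<H>"
      using assms(3) subgroup.one_closed[OF submodule.axioms(1)] by fastforce
  qed (use assms(2) E in \<open>fastforce+\<close>)
qed

lemma tensor_relations_closed:
  assumes "module R M" "module R N"
  shows "tensor_relations R M N \<subseteq> carrier (free_module R (carrier M \<times> carrier N))"
proof -
  interpret M: module R M by fact
  interpret N: module R N by fact
  interpret F: module R "free_module R (carrier M \<times> carrier N)"
    by (rule free_module_module) (rule M.R.cring_axioms)
  have "free_gen R (m, n) \<in> carrier (free_module R (carrier M \<times> carrier N))"
    if "m \<in> carrier M" "n \<in> carrier N" for m n
    by (rule free_gen_closed) (use that M.R.cring_axioms in auto)
  then show ?thesis by (auto simp: tensor_relations_def Let_def)
qed

lemma tensor_kernel_submodule: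
  assumes "module R M" "module R N"
  shows "submodule (tensor_kernel R M N) R (free_module R (carrier M \<times> carrier N))"
proof -
  have F: "module R (free_module R (carrier M \<times> carrier N))"
    using assms(1) by (intro free_module_module) (simp add: module_def)
  show ?thesis
    unfolding tensor_kernel_def hull_def
    by (rule submodule_Inter[OF F])
      (use module.carrier_is_submodule[OF F] tensor_relations_closed[OF assms] in auto)
qed

lemma quotient_module_module:
  assumes "module R M" "submodule H R M"
  shows "module R (quotient_module M H)"
    and "(\<lambda>x. H +>\<^bsub>M\<^esub> x) \<in> linear_maps R M (quotient_module M H)"
proof -
  interpret M: module R M by fact
  interpret H: submodule H R M by fact
  interpret H: additive_subgroup H M
    by (rule additive_subgroup.intro) (rule H.subgroup_axioms)
  interpret H: abelian_subgroup H M
    by (rule abelian_subgroupI3) (auto simp: H.additive_subgroup_axioms M.abelian_group_axioms)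
  have ad: "(H +>\<^bsub>M\<^esub> x) <+>\<^bsub>M\<^esub> (H +>\<^bsub>M\<^esub> y) = H +>\<^bsub>M\<^esub> (x \<oplus>\<^bsub>M\<^esub> y)"
    if "x \<in> carrier M" "y \<in> carrier M" for x y
    using that by (rule H.a_rcos_sum)
  have Hz: "H +>\<^bsub>M\<^esub> \<zero>\<^bsub>M\<^esub> = H"
    using H.a_rcos_const H.zero_closed by blast
  have car: "X \<in> a_rcosets\<^bsub>M\<^esub> H \<longleftrightarrow> (\<exists>x\<in>carrier M. X = H +>\<^bsub>M\<^esub> x)" for X
    by (auto simp: A_RCOSETS_def RCOSETS_def a_r_coset_def)
  then have carI: "H +>\<^bsub>M\<^esub> x \<in> a_rcosets\<^bsub>M\<^esub> H" if "x \<in> carrier M" for x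
    using that by blast
  have carE: thesis if "X \<in> a_rcosets\<^bsub>M\<^esub> H"
    "\<And>x. X = H +>\<^bsub>M\<^esub> x \<Longrightarrow> x \<in> carrier M \<Longrightarrow> thesis" for X thesis
    using that car by blast
  have sm: "(\<Union>y\<in>H +>\<^bsub>M\<^esub> x. H +>\<^bsub>M\<^esub> (c \<odot>\<^bsub>M\<^esub> y)) = H +>\<^bsub>M\<^esub> (c \<odot>\<^bsub>M\<^esub> x)"
    if c: "c \<in> carrier R" and x: "x \<in> carrier M" for c x
  proof -
    have "H +>\<^bsub>M\<^esub> (c \<odot>\<^bsub>M\<^esub> y) = H +>\<^bsub>M\<^esub> (c \<odot>\<^bsub>M\<^esub> x)" if y: "y \<in> H +>\<^bsub>M\<^esub> x" for y
    proof -
      obtain h where h: "h \<in> H" "y = h \<oplus>\<^bsub>M\<^esub> x"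
        using y by (auto simp: a_r_coset_def')
      have hM: "h \<in> carrier M" using h H.a_subset by auto
      have "H +>\<^bsub>M\<^esub> (c \<odot>\<^bsub>M\<^esub> y) = H +>\<^bsub>M\<^esub> (c \<odot>\<^bsub>M\<^esub> h \<oplus>\<^bsub>M\<^esub> c \<odot>\<^bsub>M\<^esub> x)"
        using h hM c x by (simp add: M.smult_r_distr)
      also have "\<dots> = (H +>\<^bsub>M\<^esub> (c \<odot>\<^bsub>M\<^esub> h)) <+>\<^bsub>M\<^esub> (H +>\<^bsub>M\<^esub> (c \<odot>\<^bsub>M\<^esub> x))"
        using hM c x by (simp add: ad)
      also have "H +>\<^bsub>M\<^esub> (c \<odot>\<^bsub>M\<^esub> h) = H +>\<^bsub>M\<^esub> \<zero>\<^bsub>M\<^esub>"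
        using c h Hz by (simp add: H.a_rcos_const)
      also have "(H +>\<^bsub>M\<^esub> \<zero>\<^bsub>M\<^esub>) <+>\<^bsub>M\<^esub> (H +>\<^bsub>M\<^esub> (c \<odot>\<^bsub>M\<^esub> x)) = H +>\<^bsub>M\<^esub> (c \<odot>\<^bsub>M\<^esub> x)"
        using c x by (simp add: ad)
      finally show ?thesis .
    qed
    moreover have "H +>\<^bsub>M\<^esub> x \<noteq> {}"
      using H.a_rcos_self x by blast
    ultimately show ?thesis by auto
  qed
  show "module R (quotient_module M H)"
  proof (rule moduleI[OF M.R.cring_axioms])
    show "abelian_group (quotient_module M H)"
    proof (rule abelian_groupI)
      fix X assume "X \<in> carrier (quotient_module M H)"
      then obtain x where x: "x \<in> carrier M" "X = H +>\<^bsub>M\<^esub> x"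
        by (auto simp: quotient_module_def elim: carE)
      have "(H +>\<^bsub>M\<^esub> \<zero>\<^bsub>M\<^esub>) <+>\<^bsub>M\<^esub> X = X" using x by (simp add: ad)
      then show "\<zero>\<^bsub>quotient_module M H\<^esub> \<oplus>\<^bsub>quotient_module M H\<^esub> X = X"
        by (simp add: quotient_module_def Hz)
      show "\<exists>Y\<in>carrier (quotient_module M H). Y \<oplus>\<^bsub>quotient_module M H\<^esub> X = \<zero>\<^bsub>quotient_module M H\<^esub>"
        using x
        by (intro bexI[of _ "H +>\<^bsub>M\<^esub> (\<ominus>\<^bsub>M\<^esub> x)"])
          (simp_all add: quotient_module_def carI ad M.l_neg Hz)
      fix Y assume "Y \<in> carrier (quotient_module M H)"
      then obtain y where y: "y \<in> carrier M" "Y = H +>\<^bsub>M\<^esub> y"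
        by (auto simp: quotient_module_def elim: carE)
      show "X \<oplus>\<^bsub>quotient_module M H\<^esub> Y \<in> carrier (quotient_module M H)"
        using x y by (simp add: quotient_module_def carI ad)
      show "X \<oplus>\<^bsub>quotient_module M H\<^esub> Y = Y \<oplus>\<^bsub>quotient_module M H\<^esub> X"
        using x y by (simp add: quotient_module_def ad M.a_comm)
      fix Z assume "Z \<in> carrier (quotient_module M H)"
      then obtain z where z: "z \<in> carrier M" "Z = H +>\<^bsub>M\<^esub> z"
        by (auto simp: quotient_module_def elim: carE)
      show "(X \<oplus>\<^bsub>quotient_module M H\<^esub> Y) \<oplus>\<^bsub>quotient_module M H\<^esub> Z = X \<oplus>\<^bsub>quotient_module M H\<^esub> (Y \<oplus>\<^bsub>quotient_module M H\<^esub> Z)"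
        using x y z by (simp add: quotient_module_def ad M.a_assoc)
    next
      show "\<zero>\<^bsub>quotient_module M H\<^esub> \<in> carrier (quotient_module M H)"
        using carI[OF M.M.zero_closed] by (simp add: quotient_module_def Hz)
    qed
  next
    fix c X assume c: "c \<in> carrier R" and "X \<in> carrier (quotient_module M H)"
    then obtain x where x: "x \<in> carrier M" "X = H +>\<^bsub>M\<^esub> x"
      by (auto simp: quotient_module_def elim: carE)
    show "c \<odot>\<^bsub>quotient_module M H\<^esub> X \<in> carrier (quotient_module M H)"
      using c x by (simp add: quotient_module_def sm carI)
    show "(c \<oplus>\<^bsub>R\<^esub> d) \<odot>\<^bsub>quotient_module M H\<^esub> X =
        c \<odot>\<^bsub>quotient_module M H\<^esub> X \<oplus>\<^bsub>quotient_module M H\<^esub> d \<odot>\<^bsub>quotient_module M H\<^esub> X"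
      if "d \<in> carrier R" for d
      using c x that by (simp add: quotient_module_def sm ad M.smult_l_distr)
    show "(c \<otimes>\<^bsub>R\<^esub> d) \<odot>\<^bsub>quotient_module M H\<^esub> X =
        c \<odot>\<^bsub>quotient_module M H\<^esub> (d \<odot>\<^bsub>quotient_module M H\<^esub> X)"
      if "d \<in> carrier R" for d
      using c x that by (simp add: quotient_module_def sm M.smult_assoc1)
    show "c \<odot>\<^bsub>quotient_module M H\<^esub> (X \<oplus>\<^bsub>quotient_module M H\<^esub> Y) =
        c \<odot>\<^bsub>quotient_module M H\<^esub> X \<oplus>\<^bsub>quotient_module M H\<^esub> c \<odot>\<^bsub>quotient_module M H\<^esub> Y"
      if Y: "Y \<in> carrier (quotient_module M H)" for Y
    proof -
      obtain y where y: "y \<in> carrier M" "Y = H +>\<^bsub>M\<^esub> y"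
        using Y by (auto simp: quotient_module_def elim: carE)
      show ?thesis using c x y by (simp add: quotient_module_def sm ad M.smult_r_distr)
    qed
  next
    fix X assume "X \<in> carrier (quotient_module M H)"
    then obtain x where x: "x \<in> carrier M" "X = H +>\<^bsub>M\<^esub> x"
      by (auto simp: quotient_module_def elim: carE)
    show "\<one>\<^bsub>R\<^esub> \<odot>\<^bsub>quotient_module M H\<^esub> X = X"
      using x by (simp add: quotient_module_def sm)
  qed
  show "(\<lambda>x. H +>\<^bsub>M\<^esub> x) \<in> linear_maps R M (quotient_module M H)"
    by (simp add: linear_maps_def quotient_module_def carI ad sm)
qed

lemma linear_map_zero:
  assumes "module R M" "module R P" "h \<in> linear_maps R M P" shows "h \<zero>\<^bsub>M\<^esub> = \<zero>\<^bsub>P\<^esub>"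
proof -
  interpret M: module R M by fact
  interpret P: module R P by fact
  have "h (\<zero>\<^bsub>R\<^esub> \<odot>\<^bsub>M\<^esub> \<zero>\<^bsub>M\<^esub>) = \<zero>\<^bsub>R\<^esub> \<odot>\<^bsub>P\<^esub> h \<zero>\<^bsub>M\<^esub>"
    using assms(3) M.R.zero_closed M.M.zero_closed unfolding linear_maps_def by blast
  moreover have "h \<zero>\<^bsub>M\<^esub> \<in> carrier P"
    using assms(3) by (auto simp: linear_maps_def)
  ultimately show ?thesis by simp
qed

lemma linear_map_uminus:
  assumes "module R M" "module R P" "h \<in> linear_maps R M P" "x \<in> carrier M"
  shows "h (\<ominus>\<^bsub>M\<^esub> x) = \<ominus>\<^bsub>P\<^esub> h x"
proof -
  interpret M: module R M by fact
  interpret P: module R P by fact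
  have "h (\<ominus>\<^bsub>M\<^esub> x \<oplus>\<^bsub>M\<^esub> x) = h (\<ominus>\<^bsub>M\<^esub> x) \<oplus>\<^bsub>P\<^esub> h x" "h x \<in> carrier P" "h (\<ominus>\<^bsub>M\<^esub> x) \<in> carrier P"
    using assms(3,4) by (auto simp: linear_maps_def)
  then show ?thesis
    using linear_map_zero[OF assms(1-3)] assms(4)
    by (simp add: M.l_neg P.minus_equality)
qed

lemma linear_map_minus:
  assumes "module R M" "module R P" "h \<in> linear_maps R M P" "x \<in> carrier M" "y \<in> carrier M"
  shows "h (x \<ominus>\<^bsub>M\<^esub> y) = h x \<ominus>\<^bsub>P\<^esub> h y"
proof -
  interpret M: module R M by fact
  show ?thesis
    using assms(3,4,5) linear_map_uminus[OF assms(1-3,5)]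
    by (simp add: a_minus_def linear_maps_def)
qed

lemma linear_map_kernel:
  assumes "module R M" "module R P" "h \<in> linear_maps R M P"
  shows "submodule {x \<in> carrier M. h x = \<zero>\<^bsub>P\<^esub>} R M"
proof -
  interpret M: module R M by fact
  interpret P: module R P by fact
  show ?thesis
    by (rule M.submoduleI)
      (use assms(3) linear_map_zero[OF assms] linear_map_uminus[OF assms] in
        \<open>auto simp: linear_maps_def\<close>)
qed

lemma free_lift_eq:
  assumes "module R P" "\<phi> \<in> X \<rightarrow> carrier P" "f \<in> carrier (free_module R X)"
    "finite S" "S \<subseteq> X" "{x. f x \<noteq> \<zero>\<^bsub>R\<^esub>} \<subseteq> S"
  shows "free_lift R P \<phi> f = (\<Oplus>\<^bsub>P\<^esub>x\<in>S. f x \<odot>\<^bsub>P\<^esub> \<phi> x)"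
proof -
  interpret P: module R P by fact
  show ?thesis
    unfolding free_lift_def
    by (rule P.add.finprod_mono_neutral_cong_left)
      (use assms in \<open>auto simp: free_module_def Pi_def intro!: P.smult_closed\<close>)
qed

lemma free_lift_linear:
  assumes "module R P" "\<phi> \<in> X \<rightarrow> carrier P"
  shows "free_lift R P \<phi> \<in> linear_maps R (free_module R X) P"
proof -
  interpret P: module R P by fact
  let ?F = "free_module R X"
  interpret F: module R ?F by (rule free_module_module) (rule P.R.cring_axioms)
  have supp: "finite {x. f x \<noteq> \<zero>\<^bsub>R\<^esub>}" "{x. f x \<noteq> \<zero>\<^bsub>R\<^esub>} \<subseteq> X"
    if "f \<in> carrier ?F" for f using that by (auto simp: free_module_def)
  have cl: "f x \<in> carrier R" if "f \<in> carrier ?F" for f x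
    using that by (cases "x \<in> X") (auto simp: free_module_def)
  have "free_lift R P \<phi> f \<in> carrier P" if f: "f \<in> carrier ?F" for f
    unfolding free_lift_def using supp[OF f] cl[OF f] assms(2)
    by (intro P.finsum_closed) auto
  moreover have "free_lift R P \<phi> (f \<oplus>\<^bsub>?F\<^esub> g) = free_lift R P \<phi> f \<oplus>\<^bsub>P\<^esub> free_lift R P \<phi> g"
    if f: "f \<in> carrier ?F" and g: "g \<in> carrier ?F" for f g
  proof -
    let ?S = "{x. f x \<noteq> \<zero>\<^bsub>R\<^esub>} \<union> {x. g x \<noteq> \<zero>\<^bsub>R\<^esub>}"
    have S: "finite ?S" "?S \<subseteq> X" using supp[OF f] supp[OF g] by auto
    have ph: "\<phi> x \<in> carrier P" if "x \<in> ?S" for x using S(2) that assms(2) by blast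
    have s: "(f \<oplus>\<^bsub>?F\<^esub> g) x = f x \<oplus>\<^bsub>R\<^esub> g x" for x by (simp add: free_module_def)
    have "free_lift R P \<phi> (f \<oplus>\<^bsub>?F\<^esub> g) = (\<Oplus>\<^bsub>P\<^esub>x\<in>?S. (f \<oplus>\<^bsub>?F\<^esub> g) x \<odot>\<^bsub>P\<^esub> \<phi> x)"
      by (rule free_lift_eq[OF assms _ S]) (use f g s in auto)
    also have "\<dots> = (\<Oplus>\<^bsub>P\<^esub>x\<in>?S. f x \<odot>\<^bsub>P\<^esub> \<phi> x \<oplus>\<^bsub>P\<^esub> g x \<odot>\<^bsub>P\<^esub> \<phi> x)"
      by (rule P.finsum_cong') (use ph cl f g in \<open>auto simp: s P.smult_l_distr\<close>)
    also have "\<dots> = (\<Oplus>\<^bsub>P\<^esub>x\<in>?S. f x \<odot>\<^bsub>P\<^esub> \<phi> x) \<oplus>\<^bsub>P\<^esub> (\<Oplus>\<^bsub>P\<^esub>x\<in>?S. g x \<odot>\<^bsub>P\<^esub> \<phi> x)"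
      by (rule P.finsum_addf) (use ph cl f g in auto)
    also have "\<dots> = free_lift R P \<phi> f \<oplus>\<^bsub>P\<^esub> free_lift R P \<phi> g"
      using free_lift_eq[OF assms f S] free_lift_eq[OF assms g S] by auto
    finally show ?thesis .
  qed
  moreover have "free_lift R P \<phi> (c \<odot>\<^bsub>?F\<^esub> f) = c \<odot>\<^bsub>P\<^esub> free_lift R P \<phi> f"
    if c: "c \<in> carrier R" and f: "f \<in> carrier ?F" for c f
  proof -
    let ?S = "{x. f x \<noteq> \<zero>\<^bsub>R\<^esub>}"
    note S = supp[OF f]
    have ph: "\<phi> x \<in> carrier P" if "x \<in> ?S" for x using S(2) that assms(2) by blast
    have s: "(c \<odot>\<^bsub>?F\<^esub> f) x = c \<otimes>\<^bsub>R\<^esub> f x" for x by (simp add: free_module_def)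
    have "free_lift R P \<phi> (c \<odot>\<^bsub>?F\<^esub> f) = (\<Oplus>\<^bsub>P\<^esub>x\<in>?S. (c \<odot>\<^bsub>?F\<^esub> f) x \<odot>\<^bsub>P\<^esub> \<phi> x)"
      by (rule free_lift_eq[OF assms _ S]) (use f c s in auto)
    also have "\<dots> = (\<Oplus>\<^bsub>P\<^esub>x\<in>?S. c \<odot>\<^bsub>P\<^esub> (f x \<odot>\<^bsub>P\<^esub> \<phi> x))"
      by (rule P.finsum_cong') (use ph cl f c in \<open>auto simp: s P.smult_assoc1\<close>)
    also have "\<dots> = c \<odot>\<^bsub>P\<^esub> free_lift R P \<phi> f"
      unfolding free_lift_def
      by (rule P.finsum_smult_ldistr[symmetric]) (use S ph cl f c in auto)
    finally show ?thesis .
  qed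
  ultimately show ?thesis by (auto simp: linear_maps_def)
qed

lemma free_lift_gen:
  assumes "module R P" "\<phi> \<in> X \<rightarrow> carrier P" "x \<in> X"
  shows "free_lift R P \<phi> (free_gen R x) = \<phi> x"
proof -
  interpret P: module R P by fact
  have p: "\<phi> x \<in> carrier P" using assms by auto
  have "free_lift R P \<phi> (free_gen R x) = (\<Oplus>\<^bsub>P\<^esub>y\<in>{x}. free_gen R x y \<odot>\<^bsub>P\<^esub> \<phi> y)"
    by (rule free_lift_eq[OF assms(1,2) free_gen_closed])
      (use assms(3) P.R.cring_axioms in \<open>auto simp: free_gen_def\<close>)
  then show ?thesis using p by (simp add: free_gen_def)
qed

lemma free_module_ext:
  assumes "module R P" "h \<in> linear_maps R (free_module R X) P"
    "h' \<in> linear_maps R (free_module R X) P"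
    "\<And>x. x \<in> X \<Longrightarrow> h (free_gen R x) = h' (free_gen R x)"
    "f \<in> carrier (free_module R X)"
  shows "h f = h' f"
proof -
  interpret P: module R P by fact
  let ?F = "free_module R X"
  have Fm: "module R ?F" by (rule free_module_module) (rule P.R.cring_axioms)
  interpret F: module R ?F by fact
  have "finite S \<Longrightarrow> f \<in> carrier ?F \<Longrightarrow> {x. f x \<noteq> \<zero>\<^bsub>R\<^esub>} \<subseteq> S \<Longrightarrow> h f = h' f" for S f
  proof (induction S arbitrary: f rule: finite_induct)
    case empty
    then have "f = \<zero>\<^bsub>?F\<^esub>" by (auto simp: free_module_def)
    then show ?case using linear_map_zero[OF Fm assms(1,2)] linear_map_zero[OF Fm assms(1,3)] by metis
  next
    case (insert x S)
    show ?case
    proof (cases "f x = \<zero>\<^bsub>R\<^esub>")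
      case True
      then show ?thesis using insert.prems by (intro insert.IH) auto
    next
      case False
      then have x: "x \<in> X" using insert.prems by (auto simp: free_module_def)
      define g where "g = f(x := \<zero>\<^bsub>R\<^esub>)"
      have "{y. g y \<noteq> \<zero>\<^bsub>R\<^esub>} \<subseteq> {y. f y \<noteq> \<zero>\<^bsub>R\<^esub>}" by (auto simp: g_def)
      then have g: "g \<in> carrier ?F"
        using insert.prems(1) by (auto simp: free_module_def g_def intro: finite_subset)
      have e: "free_gen R x \<in> carrier ?F" using x P.R.cring_axioms by (rule free_gen_closed[rotated])
      have fx: "f x \<in> carrier R" using x insert.prems(1) by (auto simp: free_module_def)
      have cl: "f y \<in> carrier R" for y
        using insert.prems(1) by (cases "y \<in> X") (auto simp: free_module_def)
      have eq: "f = f x \<odot>\<^bsub>?F\<^esub> free_gen R x \<oplus>\<^bsub>?F\<^esub> g"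
        using cl by (auto simp: free_module_def free_gen_def g_def fun_eq_iff)
      have "h g = h' g"
        by (rule insert.IH[OF g]) (use insert.prems(2) in \<open>auto simp: g_def\<close>)
      then have "h (f x \<odot>\<^bsub>?F\<^esub> free_gen R x \<oplus>\<^bsub>?F\<^esub> g) = h' (f x \<odot>\<^bsub>?F\<^esub> free_gen R x \<oplus>\<^bsub>?F\<^esub> g)"
        using assms(2-4) e g fx x by (simp add: linear_maps_def)
      then show ?thesis using eq by metis
    qed
  qed
  then show ?thesis using assms(5) by (auto simp: free_module_def)
qed

lemma tensor_kernel_le:
  assumes "module R M" "module R N" "module R P" "\<phi> \<in> bilinear_maps R M N P"
    "k \<in> tensor_kernel R M N"
  shows "free_lift R P (\<lambda>(m, n). \<phi> m n) k = \<zero>\<^bsub>P\<^esub>"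
proof -
  interpret M: module R M by fact
  interpret N: module R N by fact
  interpret P: module R P by fact
  let ?X = "carrier M \<times> carrier N" let ?F = "free_module R ?X"
  let ?h = "free_lift R P (\<lambda>(m, n). \<phi> m n)"
  have Fm: "module R ?F" by (rule free_module_module) (rule M.R.cring_axioms)
  interpret F: module R ?F by fact
  have cl: "\<phi> m n \<in> carrier P" if "m \<in> carrier M" "n \<in> carrier N" for m n
    using assms(4) that by (auto simp: bilinear_maps_def linear_maps_def)
  then have ph: "(\<lambda>(m, n). \<phi> m n) \<in> ?X \<rightarrow> carrier P" by auto
  note h = free_lift_linear[OF assms(3) ph]
  note K = linear_map_kernel[OF Fm assms(3) h]
  have gen: "?h (free_gen R (m, n)) = \<phi> m n" if "m \<in> carrier M" "n \<in> carrier N" for m n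
    using free_lift_gen[OF assms(3) ph, of "(m, n)"] that by auto
  have gc: "free_gen R (m, n) \<in> carrier ?F" if "m \<in> carrier M" "n \<in> carrier N" for m n
    by (rule free_gen_closed) (use that M.R.cring_axioms in auto)
  have had: "?h (x \<oplus>\<^bsub>?F\<^esub> y) = ?h x \<oplus>\<^bsub>P\<^esub> ?h y" if "x \<in> carrier ?F" "y \<in> carrier ?F" for x y
    using h that by (auto simp: linear_maps_def)
  have hsm: "?h (c \<odot>\<^bsub>?F\<^esub> x) = c \<odot>\<^bsub>P\<^esub> ?h x" if "c \<in> carrier R" "x \<in> carrier ?F" for x c
    using h that by (auto simp: linear_maps_def)
  note hmi = linear_map_minus[OF Fm assms(3) h]
  have b: "\<phi> (m \<oplus>\<^bsub>M\<^esub> m') n = \<phi> m n \<oplus>\<^bsub>P\<^esub> \<phi> m' n" "\<phi> m (n \<oplus>\<^bsub>N\<^esub> n') = \<phi> m n \<oplus>\<^bsub>P\<^esub> \<phi> m n'"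
    "c \<in> carrier R \<Longrightarrow> \<phi> (c \<odot>\<^bsub>M\<^esub> m) n = c \<odot>\<^bsub>P\<^esub> \<phi> m n"
    "c \<in> carrier R \<Longrightarrow> \<phi> m (c \<odot>\<^bsub>N\<^esub> n) = c \<odot>\<^bsub>P\<^esub> \<phi> m n"
    if "m \<in> carrier M" "n \<in> carrier N" "m' \<in> carrier M" "n' \<in> carrier N" for m n m' n' c
    using assms(4) that by (auto simp: bilinear_maps_def linear_maps_def)
  have "?h x = \<zero>\<^bsub>P\<^esub>" if "x \<in> tensor_relations R M N" for x
    using that unfolding tensor_relations_def Let_def
    by (auto simp: hmi had hsm gen gc cl b)
      (auto simp: a_minus_def P.r_neg cl b)
  then have "tensor_relations R M N \<subseteq> {x \<in> carrier ?F. ?h x = \<zero>\<^bsub>P\<^esub>}"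
    using tensor_relations_closed[OF assms(1,2)] by auto
  then have "tensor_kernel R M N \<subseteq> {x \<in> carrier ?F. ?h x = \<zero>\<^bsub>P\<^esub>}"
    unfolding tensor_kernel_def using K by (intro hull_minimal)
  then show ?thesis using assms(5) by auto
qed


lemma tensor_module_module:
  assumes "module R M" "module R N" shows "module R (tensor_module R M N)"
proof -
  have F: "module R (free_module R (carrier M \<times> carrier N))"
    using assms(1) by (intro free_module_module) (simp add: module_def)
  show ?thesis
    unfolding tensor_module_def
    by (rule quotient_module_module(1)[OF F tensor_kernel_submodule[OF assms]])
qed

lemma pure_tensor_bilinear:
  assumes "module R M" "module R N"
  shows "pure_tensor R M N \<in> bilinear_maps R M N (tensor_module R M N)"
proof -
  interpret M: module R M by fact
  interpret N: module R N by fact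
  let ?F = "free_module R (carrier M \<times> carrier N)" and ?K = "tensor_kernel R M N"
  let ?q = "\<lambda>x. ?K +>\<^bsub>?F\<^esub> x" and ?T = "tensor_module R M N"
  have Fm: "module R ?F" by (rule free_module_module) (rule M.R.cring_axioms)
  interpret F: module R ?F by fact
  have Tm: "module R ?T" by (rule tensor_module_module) fact+
  interpret T: module R ?T by fact
  have S: "submodule ?K R ?F" by (rule tensor_kernel_submodule) fact+
  have q: "?q \<in> linear_maps R ?F ?T"
    unfolding tensor_module_def by (rule quotient_module_module(2)[OF Fm S])
  interpret K: additive_subgroup ?K ?F
    by (rule additive_subgroup.intro) (use S in \<open>simp add: submodule_def\<close>)
  have gc: "free_gen R (m, n) \<in> carrier ?F" if "m \<in> carrier M" "n \<in> carrier N" for m n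
    by (rule free_gen_closed) (use that M.R.cring_axioms in auto)
  have zero: "?q x = \<zero>\<^bsub>?T\<^esub>" if "x \<in> ?K" for x
    using that F.add.coset_join2[of x ?K] K.a_subset K.a_subgroup
    by (auto simp: tensor_module_def quotient_module_def a_r_coset_def)
  have rel: "?q x = ?q y"
    if "x \<ominus>\<^bsub>?F\<^esub> y \<in> tensor_relations R M N" "x \<in> carrier ?F" "y \<in> carrier ?F" for x y
  proof -
    have "x \<ominus>\<^bsub>?F\<^esub> y \<in> ?K"
      using that(1) unfolding tensor_kernel_def by (rule hull_inc)
    then have "?q x \<ominus>\<^bsub>?T\<^esub> ?q y = \<zero>\<^bsub>?T\<^esub>"
      using zero linear_map_minus[OF Fm Tm q that(2,3)] by simp
    moreover have "?q x \<in> carrier ?T" "?q y \<in> carrier ?T"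
      using q that by (auto simp: linear_maps_def)
    ultimately show ?thesis by (metis T.minus_eq T.minus_equality T.minus_minus T.a_inv_closed)
  qed
  have qa: "?q (x \<oplus>\<^bsub>?F\<^esub> y) = ?q x \<oplus>\<^bsub>?T\<^esub> ?q y" if "x \<in> carrier ?F" "y \<in> carrier ?F" for x y
    using q that by (auto simp: linear_maps_def)
  have qs: "?q (c \<odot>\<^bsub>?F\<^esub> x) = c \<odot>\<^bsub>?T\<^esub> ?q x" if "c \<in> carrier R" "x \<in> carrier ?F" for x c
    using q that by (auto simp: linear_maps_def)
  have qc: "?q x \<in> carrier ?T" if "x \<in> carrier ?F" for x
    using q that by (auto simp: linear_maps_def)
  have "pure_tensor R M N (m \<oplus>\<^bsub>M\<^esub> m') n = pure_tensor R M N m n \<oplus>\<^bsub>?T\<^esub> pure_tensor R M N m' n"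
    if "m \<in> carrier M" "m' \<in> carrier M" "n \<in> carrier N" for m m' n
    unfolding pure_tensor_def using that
    by (subst qa[symmetric], (intro gc; simp), (intro gc; simp), intro rel)
      (auto simp: gc tensor_relations_def Let_def)
  moreover have "pure_tensor R M N m (n \<oplus>\<^bsub>N\<^esub> n') = pure_tensor R M N m n \<oplus>\<^bsub>?T\<^esub> pure_tensor R M N m n'"
    if "m \<in> carrier M" "n \<in> carrier N" "n' \<in> carrier N" for m n n'
    unfolding pure_tensor_def using that
    by (subst qa[symmetric], (intro gc; simp), (intro gc; simp), intro rel)
      (auto simp: gc tensor_relations_def Let_def)
  moreover have "pure_tensor R M N (c \<odot>\<^bsub>M\<^esub> m) n = c \<odot>\<^bsub>?T\<^esub> pure_tensor R M N m n"
    if "c \<in> carrier R" "m \<in> carrier M" "n \<in> carrier N" for c m n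
    unfolding pure_tensor_def using that
    by (subst qs[symmetric], simp, (intro gc; simp), intro rel)
      (auto simp: gc tensor_relations_def Let_def)
  moreover have "pure_tensor R M N m (c \<odot>\<^bsub>N\<^esub> n) = c \<odot>\<^bsub>?T\<^esub> pure_tensor R M N m n"
    if "c \<in> carrier R" "m \<in> carrier M" "n \<in> carrier N" for c m n
    unfolding pure_tensor_def using that
    by (subst qs[symmetric], simp, (intro gc; simp), intro rel)
      (auto simp: gc tensor_relations_def Let_def)
  moreover have "pure_tensor R M N m n \<in> carrier ?T"
    if "m \<in> carrier M" "n \<in> carrier N" for m n
    unfolding pure_tensor_def using that by (intro qc gc)
  ultimately show ?thesis by (simp add: bilinear_maps_def linear_maps_def)
qed

lemma tensor_lift_coset:
  assumes "module R M" "module R N" "module R P" "\<phi> \<in> bilinear_maps R M N P"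
    "f \<in> carrier (free_module R (carrier M \<times> carrier N))"
  shows "tensor_lift R P \<phi> (tensor_kernel R M N +>\<^bsub>free_module R (carrier M \<times> carrier N)\<^esub> f) =
    free_lift R P (\<lambda>(m, n). \<phi> m n) f"
proof -
  interpret M: module R M by fact
  interpret P: module R P by fact
  let ?F = "free_module R (carrier M \<times> carrier N)" and ?K = "tensor_kernel R M N"
  let ?h = "free_lift R P (\<lambda>(m, n). \<phi> m n)"
  have Fm: "module R ?F" by (rule free_module_module) (rule M.R.cring_axioms)
  have S: "submodule ?K R ?F" by (rule tensor_kernel_submodule) fact+
  have K: "?K \<subseteq> carrier ?F" "?K \<noteq> {}" using module.submoduleE(1,2)[OF Fm S] by auto
  have ph: "(\<lambda>(m, n). \<phi> m n) \<in> carrier M \<times> carrier N \<rightarrow> carrier P"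
    using assms(4) by (auto simp: bilinear_maps_def linear_maps_def)
  note h = free_lift_linear[OF assms(3) ph]
  have "?h (k \<oplus>\<^bsub>?F\<^esub> f) = ?h f" if "k \<in> ?K" for k
  proof -
    have "?h (k \<oplus>\<^bsub>?F\<^esub> f) = ?h k \<oplus>\<^bsub>P\<^esub> ?h f" "?h f \<in> carrier P"
      using h subsetD[OF K(1) that] assms(5) by (simp_all add: linear_maps_def Pi_iff)
    then show ?thesis using tensor_kernel_le[OF assms(1-4) that] by simp
  qed
  then have "?h ` (?K +>\<^bsub>?F\<^esub> f) = {?h f}"
    using K(2) by (auto simp: a_r_coset_def' image_UN)
  then show ?thesis by (simp add: tensor_lift_def)
qed

lemma tensor_lift_linear:
  assumes "module R M" "module R N" "module R P" "\<phi> \<in> bilinear_maps R M N P"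
  shows "tensor_lift R P \<phi> \<in> linear_maps R (tensor_module R M N) P"
proof -
  interpret M: module R M by fact
  let ?F = "free_module R (carrier M \<times> carrier N)" and ?K = "tensor_kernel R M N"
  let ?q = "\<lambda>x. ?K +>\<^bsub>?F\<^esub> x" and ?T = "tensor_module R M N"
  let ?h = "free_lift R P (\<lambda>(m, n). \<phi> m n)"
  have Fm: "module R ?F" by (rule free_module_module) (rule M.R.cring_axioms)
  interpret F: module R ?F by fact
  have S: "submodule ?K R ?F" by (rule tensor_kernel_submodule) fact+
  have q: "?q \<in> linear_maps R ?F ?T"
    unfolding tensor_module_def by (rule quotient_module_module(2)[OF Fm S])
  have ph: "(\<lambda>(m, n). \<phi> m n) \<in> carrier M \<times> carrier N \<rightarrow> carrier P"
    using assms(4) by (auto simp: bilinear_maps_def linear_maps_def)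
  note h = free_lift_linear[OF assms(3) ph]
  note L = tensor_lift_coset[OF assms]
  have rep: "\<exists>x\<in>carrier ?F. X = ?q x" if "X \<in> carrier ?T" for X
    using that by (auto simp: tensor_module_def quotient_module_def A_RCOSETS_def RCOSETS_def a_r_coset_def)
  have qa: "?q x \<oplus>\<^bsub>?T\<^esub> ?q y = ?q (x \<oplus>\<^bsub>?F\<^esub> y)" if "x \<in> carrier ?F" "y \<in> carrier ?F" for x y
    using q that by (auto simp: linear_maps_def)
  have qs: "c \<odot>\<^bsub>?T\<^esub> ?q x = ?q (c \<odot>\<^bsub>?F\<^esub> x)" if "c \<in> carrier R" "x \<in> carrier ?F" for x c
    using q that by (auto simp: linear_maps_def)
  have hh: "?h x \<in> carrier P" "?h (x \<oplus>\<^bsub>?F\<^esub> y) = ?h x \<oplus>\<^bsub>P\<^esub> ?h y"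
    "c \<in> carrier R \<Longrightarrow> ?h (c \<odot>\<^bsub>?F\<^esub> x) = c \<odot>\<^bsub>P\<^esub> ?h x"
    if "x \<in> carrier ?F" "y \<in> carrier ?F" for x y c
    using h that by (auto simp: linear_maps_def)
  show ?thesis
    by (auto simp: linear_maps_def qa qs L hh dest!: rep)
qed

lemma tensor_lift_pure:
  assumes "module R M" "module R N" "module R P" "\<phi> \<in> bilinear_maps R M N P"
    "m \<in> carrier M" "n \<in> carrier N"
  shows "tensor_lift R P \<phi> (pure_tensor R M N m n) = \<phi> m n"
proof -
  interpret M: module R M by fact
  have ph: "(\<lambda>(m, n). \<phi> m n) \<in> carrier M \<times> carrier N \<rightarrow> carrier P"
    using assms(4) by (auto simp: bilinear_maps_def linear_maps_def)
  have "free_gen R (m, n) \<in> carrier (free_module R (carrier M \<times> carrier N))"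
    by (rule free_gen_closed) (use assms(5,6) M.R.cring_axioms in auto)
  from tensor_lift_coset[OF assms(1-4) this] show ?thesis
    using free_lift_gen[OF assms(3) ph, of "(m, n)"] assms(5,6) by (simp add: pure_tensor_def)
qed

lemma tensor_lift_unique:
  assumes "module R M" "module R N" "module R P"
    "h \<in> linear_maps R (tensor_module R M N) P" "h' \<in> linear_maps R (tensor_module R M N) P"
    "\<And>m n. m \<in> carrier M \<Longrightarrow> n \<in> carrier N \<Longrightarrow>
      h (pure_tensor R M N m n) = h' (pure_tensor R M N m n)"
    "X \<in> carrier (tensor_module R M N)"
  shows "h X = h' X"
proof -
  interpret M: module R M by fact
  let ?F = "free_module R (carrier M \<times> carrier N)" and ?K = "tensor_kernel R M N"
  let ?q = "\<lambda>x. ?K +>\<^bsub>?F\<^esub> x" and ?T = "tensor_module R M N"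
  have Fm: "module R ?F" by (rule free_module_module) (rule M.R.cring_axioms)
  have S: "submodule ?K R ?F" by (rule tensor_kernel_submodule) fact+
  have q: "?q \<in> linear_maps R ?F ?T"
    unfolding tensor_module_def by (rule quotient_module_module(2)[OF Fm S])
  obtain x where x: "x \<in> carrier ?F" "X = ?q x"
    using assms(7) by (auto simp: tensor_module_def quotient_module_def A_RCOSETS_def RCOSETS_def a_r_coset_def)
  have comp: "(\<lambda>x. g (?q x)) \<in> linear_maps R ?F P" if g: "g \<in> linear_maps R ?T P" for g
    using q g by (auto simp: linear_maps_def Pi_def)
  show ?thesis
    unfolding x(2)
    by (rule free_module_ext[OF assms(3) comp[OF assms(4)] comp[OF assms(5)] _ x(1)])
      (use assms(6) in \<open>auto simp: pure_tensor_def\<close>)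
qed


subsection \<open>Tensor products of algebras and of linear maps\<close>

text \<open>The tensor product with the multiplication induced by
  \<open>(a \<otimes> b) (a' \<otimes> b') = a a' \<otimes> b b'\<close>. The underlying module does not depend on the
  multiplications of the factors.\<close>

definition tensor_prod ::
  "('k, 'r) ring_scheme \<Rightarrow> ('k, 'a, 'm) module_scheme \<Rightarrow> ('k, 'b, 'n) module_scheme \<Rightarrow>
    ('k, ('k, 'a, 'b) tensor) module"
  where "tensor_prod R A B =
    (let T = tensor_module R A B in
      T\<lparr>mult := (\<lambda>X Y. tensor_lift R T (\<lambda>a b. tensor_lift R T (\<lambda>a' b'.
            pure_tensor R A B (a \<otimes>\<^bsub>A\<^esub> a') (b \<otimes>\<^bsub>B\<^esub> b')) Y) X),
        one := pure_tensor R A B \<one>\<^bsub>A\<^esub> \<one>\<^bsub>B\<^esub>\<rparr>)"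

definition tensor_map ::
  "('k, 'r) ring_scheme \<Rightarrow> ('k, 'c, 'm) module_scheme \<Rightarrow> ('k, 'd, 'n) module_scheme \<Rightarrow>
    ('a \<Rightarrow> 'c) \<Rightarrow> ('b \<Rightarrow> 'd) \<Rightarrow> ('k, 'a, 'b) tensor \<Rightarrow> ('k, 'c, 'd) tensor"
  where "tensor_map R M' N' f g =
    tensor_lift R (tensor_prod R M' N') (\<lambda>m n. pure_tensor R M' N' (f m) (g n))"

text \<open>The canonical isomorphism \<open>L \<otimes> (M \<otimes> N) \<rightarrow> (L \<otimes> M) \<otimes> N\<close>.\<close>

definition tensor_assoc ::
  "('k, 'r) ring_scheme \<Rightarrow> ('k, 'a, 'l) module_scheme \<Rightarrow> ('k, 'b, 'm) module_scheme \<Rightarrow>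
    ('k, 'c, 'n) module_scheme \<Rightarrow>
    ('k, 'a, ('k, 'b, 'c) tensor) tensor \<Rightarrow> ('k, ('k, 'a, 'b) tensor, 'c) tensor"
  where "tensor_assoc R L M N =
    (let LM = tensor_prod R L M; P = tensor_prod R LM N in
      tensor_lift R P (\<lambda>x. tensor_lift R P (\<lambda>m n.
        pure_tensor R LM N (pure_tensor R L M x m) n)))"


section \<open>The associative Yang-Baxter equation and infinitesimal unitary bialgebras\<close>

text \<open>\<open>A \<otimes> A \<otimes> A\<close> is read as \<open>(A \<otimes> A) \<otimes> A\<close>.\<close>

abbreviation tensor2 ::
  "('k, 'r) ring_scheme \<Rightarrow> ('k, 'a, 'm) module_scheme \<Rightarrow> ('k, ('k, 'a, 'a) tensor) module"
  where "tensor2 R A \<equiv> tensor_prod R A A"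

abbreviation tensor3 ::
  "('k, 'r) ring_scheme \<Rightarrow> ('k, 'a, 'm) module_scheme \<Rightarrow>
    ('k, ('k, ('k, 'a, 'a) tensor, 'a) tensor) module"
  where "tensor3 R A \<equiv> tensor_prod R (tensor2 R A) A"

definition pure_tensor3 ::
  "('k, 'r) ring_scheme \<Rightarrow> ('k, 'a, 'm) module_scheme \<Rightarrow> 'a \<Rightarrow> 'a \<Rightarrow> 'a \<Rightarrow>
    ('k, ('k, 'a, 'a) tensor, 'a) tensor"
  where "pure_tensor3 R A x y z = pure_tensor R (tensor2 R A) A (pure_tensor R A A x y) z"

definition left_act ::
  "('k, 'r) ring_scheme \<Rightarrow> ('k, 'a, 'm) module_scheme \<Rightarrow>
    'a \<Rightarrow> ('k, 'a, 'a) tensor \<Rightarrow> ('k, 'a, 'a) tensor"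
  where "left_act R A a =
    tensor_lift R (tensor2 R A) (\<lambda>b c. pure_tensor R A A (a \<otimes>\<^bsub>A\<^esub> b) c)"

definition right_act ::
  "('k, 'r) ring_scheme \<Rightarrow> ('k, 'a, 'm) module_scheme \<Rightarrow>
    ('k, 'a, 'a) tensor \<Rightarrow> 'a \<Rightarrow> ('k, 'a, 'a) tensor"
  where "right_act R A x a =
    tensor_lift R (tensor2 R A) (\<lambda>b c. pure_tensor R A A b (c \<otimes>\<^bsub>A\<^esub> a)) x"

definition leg12 ::
  "('k, 'r) ring_scheme \<Rightarrow> ('k, 'a, 'm) module_scheme \<Rightarrow>
    ('k, 'a, 'a) tensor \<Rightarrow> ('k, ('k, 'a, 'a) tensor, 'a) tensor"
  where
  "leg12 R A = tensor_lift R (tensor3 R A) (\<lambda>u v. pure_tensor3 R A u v \<one>\<^bsub>A\<^esub>)"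

definition leg13 ::
  "('k, 'r) ring_scheme \<Rightarrow> ('k, 'a, 'm) module_scheme \<Rightarrow>
    ('k, 'a, 'a) tensor \<Rightarrow> ('k, ('k, 'a, 'a) tensor, 'a) tensor"
  where
  "leg13 R A = tensor_lift R (tensor3 R A) (\<lambda>u v. pure_tensor3 R A u \<one>\<^bsub>A\<^esub> v)"

definition leg23 ::
  "('k, 'r) ring_scheme \<Rightarrow> ('k, 'a, 'm) module_scheme \<Rightarrow>
    ('k, 'a, 'a) tensor \<Rightarrow> ('k, ('k, 'a, 'a) tensor, 'a) tensor"
  where
  "leg23 R A = tensor_lift R (tensor3 R A) (\<lambda>u v. pure_tensor3 R A \<one>\<^bsub>A\<^esub> u v)"

definition AYBE_solution ::
  "('k, 'r) ring_scheme \<Rightarrow> ('k, 'a, 'm) module_scheme \<Rightarrow> 'k \<Rightarrow> ('k, 'a, 'a) tensor \<Rightarrow> bool"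
  where "AYBE_solution R A l r \<longleftrightarrow>
    (let T = tensor3 R A; r12 = leg12 R A r; r13 = leg13 R A r; r23 = leg23 R A r in
      ((r13 \<otimes>\<^bsub>T\<^esub> r12) \<ominus>\<^bsub>T\<^esub> (r12 \<otimes>\<^bsub>T\<^esub> r23)) \<oplus>\<^bsub>T\<^esub> (r23 \<otimes>\<^bsub>T\<^esub> r13) = l \<odot>\<^bsub>T\<^esub> r13)"

locale infinitesimal_unitary_bialgebra =
  unital_algebra R A for R (structure) and A (structure) +
  fixes l and \<Delta>
  assumes weight_closed: "l \<in> carrier R"
    and comult_linear: "\<Delta> \<in> linear_maps R A (tensor2 R A)"
    and coassociative:
      "a \<in> carrier A \<Longrightarrow>
        tensor_map R (tensor2 R A) A \<Delta> (\<lambda>x. x) (\<Delta> a) =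
        tensor_assoc R A A A (tensor_map R A (tensor2 R A) (\<lambda>x. x) \<Delta> (\<Delta> a))"
    and comult_mult:
      "\<lbrakk>a \<in> carrier A; b \<in> carrier A\<rbrakk> \<Longrightarrow>
        \<Delta> (a \<otimes>\<^bsub>A\<^esub> b) =
        (left_act R A a (\<Delta> b) \<oplus>\<^bsub>tensor2 R A\<^esub> right_act R A (\<Delta> a) b)
          \<oplus>\<^bsub>tensor2 R A\<^esub> l \<odot>\<^bsub>tensor2 R A\<^esub> pure_tensor R A A a b"

definition comult_of ::
  "('k, 'r) ring_scheme \<Rightarrow> ('k, 'a, 'm) module_scheme \<Rightarrow> 'k \<Rightarrow> ('k, 'a, 'a) tensor \<Rightarrow>
    'a \<Rightarrow> ('k, 'a, 'a) tensor"
  where "comult_of R A l r a =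
    (left_act R A a r \<ominus>\<^bsub>tensor2 R A\<^esub> right_act R A r a)
      \<ominus>\<^bsub>tensor2 R A\<^esub> l \<odot>\<^bsub>tensor2 R A\<^esub> pure_tensor R A A a \<one>\<^bsub>A\<^esub>"

end

theory Submission
  imports Defs
begin

text \<open>The legs are algebra homomorphisms \<open>A \<otimes> A \<rightarrow> A \<otimes> A \<otimes> A\<close>, and the two actions on \<open>A \<otimes> A\<close> are
  multiplications by \<open>a \<otimes> 1\<close> on the left and by \<open>1 \<otimes> a\<close> on the right. So everything can be computed
  inside the algebras \<open>A \<otimes> A\<close> and \<open>A \<otimes> A \<otimes> A\<close>: for \<open>X \<in> A \<otimes> A\<close>, checking on pure tensors gives
  \<open>(\<Delta> \<otimes> id) X = X\<^sub>1\<^sub>3 r\<^sub>1\<^sub>2 - r\<^sub>1\<^sub>2 X\<^sub>2\<^sub>3 - \<lambda> X\<^sub>1\<^sub>3\<close> and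
  \<open>(id \<otimes> \<Delta>) X = X\<^sub>1\<^sub>2 r\<^sub>2\<^sub>3 - r\<^sub>2\<^sub>3 X\<^sub>1\<^sub>3 - \<lambda> X\<^sub>1\<^sub>2\<close>.
  For \<open>X = \<Delta> a\<close> the difference of the two is \<open>a\<^sub>1 E - E a\<^sub>3\<close>, where
  \<open>E = r\<^sub>1\<^sub>3 r\<^sub>1\<^sub>2 - r\<^sub>1\<^sub>2 r\<^sub>2\<^sub>3 + r\<^sub>2\<^sub>3 r\<^sub>1\<^sub>3 - \<lambda> r\<^sub>1\<^sub>3\<close>, because \<open>a\<^sub>3\<close> commutes with \<open>r\<^sub>1\<^sub>2\<close> and \<open>a\<^sub>1\<close> with \<open>r\<^sub>2\<^sub>3\<close>.\<close>

section \<open>Linear and bilinear maps\<close>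

lemma linear_mapsI:
  assumes "\<And>x. x \<in> carrier M \<Longrightarrow> h x \<in> carrier N"
    and "\<And>x y. x \<in> carrier M \<Longrightarrow> y \<in> carrier M \<Longrightarrow> h (x \<oplus>\<^bsub>M\<^esub> y) = h x \<oplus>\<^bsub>N\<^esub> h y"
    and "\<And>c x. c \<in> carrier R \<Longrightarrow> x \<in> carrier M \<Longrightarrow> h (c \<odot>\<^bsub>M\<^esub> x) = c \<odot>\<^bsub>N\<^esub> h x"
  shows "h \<in> linear_maps R M N"
  using assms by (simp add: linear_maps_def)

lemma linear_mapsD:
  assumes "h \<in> linear_maps R M N"
  shows "x \<in> carrier M \<Longrightarrow> h x \<in> carrier N"
    and "x \<in> carrier M \<Longrightarrow> y \<in> carrier M \<Longrightarrow> h (x \<oplus>\<^bsub>M\<^esub> y) = h x \<oplus>\<^bsub>N\<^esub> h y"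
    and "c \<in> carrier R \<Longrightarrow> x \<in> carrier M \<Longrightarrow> h (c \<odot>\<^bsub>M\<^esub> x) = c \<odot>\<^bsub>N\<^esub> h x"
  using assms by (auto simp: linear_maps_def)

lemma bilinear_mapsI:
  assumes "\<And>m. m \<in> carrier M \<Longrightarrow> \<phi> m \<in> linear_maps R N P"
    and "\<And>n. n \<in> carrier N \<Longrightarrow> (\<lambda>m. \<phi> m n) \<in> linear_maps R M P"
  shows "\<phi> \<in> bilinear_maps R M N P"
  using assms by (simp add: bilinear_maps_def)

lemma linear_maps_id: "(\<lambda>x. x) \<in> linear_maps R M M"
  by (simp add: linear_maps_def)

lemma linear_maps_compose:
  assumes "h \<in> linear_maps R M N" "g \<in> linear_maps R N P"
  shows "(\<lambda>x. g (h x)) \<in> linear_maps R M P"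
  using assms by (auto simp: linear_maps_def Pi_def)

lemma linear_maps_add:
  assumes "module R P" "h \<in> linear_maps R M P" "g \<in> linear_maps R M P"
  shows "(\<lambda>x. h x \<oplus>\<^bsub>P\<^esub> g x) \<in> linear_maps R M P"
proof -
  interpret P: module R P by fact
  show ?thesis
    by (rule linear_mapsI)
      (simp_all add: linear_mapsD[OF assms(2)] linear_mapsD[OF assms(3)] P.a_ac P.smult_r_distr)
qed

text \<open>Commutativity of \<open>R\<close> enters here: scaling by \<open>c\<close> commutes with
  scaling by any other scalar.\<close>

lemma linear_maps_smult:
  assumes "module R P" "h \<in> linear_maps R M P" "c \<in> carrier R"
  shows "(\<lambda>x. c \<odot>\<^bsub>P\<^esub> h x) \<in> linear_maps R M P"
proof -
  interpret P: module R P by fact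
  show ?thesis
    by (rule linear_mapsI)
      (simp_all add: linear_mapsD[OF assms(2)] assms(3) P.smult_r_distr
        P.smult_assoc1[symmetric] P.R.m_comm)
qed

lemma linear_maps_minus:
  assumes "module R P" "h \<in> linear_maps R M P" "g \<in> linear_maps R M P"
  shows "(\<lambda>x. h x \<ominus>\<^bsub>P\<^esub> g x) \<in> linear_maps R M P"
proof -
  interpret P: module R P by fact
  show ?thesis
    by (rule linear_mapsI)
      (simp_all add: linear_mapsD[OF assms(2)] linear_mapsD[OF assms(3)] a_minus_def P.a_ac
        P.minus_add P.smult_r_distr P.smult_r_minus)
qed

context unital_algebra
begin

lemma mult_left_linear:
  "c \<in> carrier A \<Longrightarrow> (\<lambda>x. c \<otimes>\<^bsub>A\<^esub> x) \<in> linear_maps R A A"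
  by (rule linear_mapsI) (simp_all add: A.r_distr smult_mult_right)

lemma mult_right_linear:
  "c \<in> carrier A \<Longrightarrow> (\<lambda>x. x \<otimes>\<^bsub>A\<^esub> c) \<in> linear_maps R A A"
  by (rule linear_mapsI) (simp_all add: A.l_distr smult_mult_left)

end


section \<open>The tensor product of two algebras\<close>

lemma tensor_prod_simps:
  "carrier (tensor_prod R M N) = carrier (tensor_module R M N)"
  "x \<oplus>\<^bsub>tensor_prod R M N\<^esub> y = x \<oplus>\<^bsub>tensor_module R M N\<^esub> y"
  "c \<odot>\<^bsub>tensor_prod R M N\<^esub> x = c \<odot>\<^bsub>tensor_module R M N\<^esub> x"
  "\<zero>\<^bsub>tensor_prod R M N\<^esub> = \<zero>\<^bsub>tensor_module R M N\<^esub>"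
  by (simp_all add: tensor_prod_def Let_def)

text \<open>Linearity refers only to the carrier, the addition and the scalar action, which
  \<open>tensor_prod\<close> takes unchanged from \<open>tensor_module\<close>; results about the
  latter are transferred this way.\<close>

lemma linear_maps_tensor_prod:
  "linear_maps R (tensor_prod R M N) P = linear_maps R (tensor_module R M N) P"
  "linear_maps R P (tensor_prod R M N) = linear_maps R P (tensor_module R M N)"
  by (simp_all add: linear_maps_def tensor_prod_simps)

lemma tensor_prod_module:
  assumes "module R M" "module R N" shows "module R (tensor_prod R M N)"
proof -
  interpret T: module R "tensor_module R M N" by (rule tensor_module_module) fact+
  show ?thesis
  proof (rule moduleI[OF T.R.cring_axioms])
    show "abelian_group (tensor_prod R M N)"
      by (rule abelian_groupI)
        (use T.add.l_inv_ex in \<open>auto simp: tensor_prod_simps T.a_ac\<close>)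
  qed (simp_all add: tensor_prod_simps T.smult_l_distr T.smult_r_distr T.smult_assoc1)
qed

lemma pure_tensor_linear:
  assumes "module R M" "module R N"
  shows "m \<in> carrier M \<Longrightarrow> pure_tensor R M N m \<in> linear_maps R N (tensor_prod R M N)"
    and "n \<in> carrier N \<Longrightarrow> (\<lambda>m. pure_tensor R M N m n) \<in> linear_maps R M (tensor_prod R M N)"
  using pure_tensor_bilinear[OF assms] by (simp_all add: bilinear_maps_def linear_maps_tensor_prod)

lemma pure_tensor_closed:
  assumes "module R M" "module R N" "m \<in> carrier M" "n \<in> carrier N"
  shows "pure_tensor R M N m n \<in> carrier (tensor_prod R M N)"
  using linear_mapsD(1)[OF pure_tensor_linear(1)[OF assms(1-3)] assms(4)] .

lemma tensor_prod_lift_linear: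
  assumes "module R M" "module R N" "module R P" "\<phi> \<in> bilinear_maps R M N P"
  shows "tensor_lift R P \<phi> \<in> linear_maps R (tensor_prod R M N) P"
  using tensor_lift_linear[OF assms] by (simp add: linear_maps_tensor_prod)

text \<open>The device behind nearly all identities below: both sides are shown to be linear in a
  tensor and are then compared on pure tensors only.\<close>

lemma tensor_prod_ext:
  assumes "module R M" "module R N" "module R P"
    "h \<in> linear_maps R (tensor_prod R M N) P" "h' \<in> linear_maps R (tensor_prod R M N) P"
    "\<And>m n. m \<in> carrier M \<Longrightarrow> n \<in> carrier N \<Longrightarrow>
      h (pure_tensor R M N m n) = h' (pure_tensor R M N m n)"
    "X \<in> carrier (tensor_prod R M N)"
  shows "h X = h' X"
  by (rule tensor_lift_unique[OF assms(1-3)])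
    (use assms(4-7) in \<open>simp_all add: linear_maps_tensor_prod tensor_prod_simps\<close>)

text \<open>For fixed \<open>x\<close> the lift is linear in its tensor argument, so each law of
  linearity in \<open>x\<close> can be checked on pure tensors, where the lift is
  \<open>\<phi> x m n\<close>. This is how iterated lifts, as in the multiplication and in
  \<open>tensor_assoc\<close>, are seen to be bilinear.\<close>

lemma tensor_lift_linear_param:
  assumes "module R L" "module R M" "module R N" "module R P"
    and bil: "\<And>x. x \<in> carrier L \<Longrightarrow> \<phi> x \<in> bilinear_maps R M N P"
    and lin: "\<And>m n. m \<in> carrier M \<Longrightarrow> n \<in> carrier N \<Longrightarrow> (\<lambda>x. \<phi> x m n) \<in> linear_maps R L P"
    and Y: "Y \<in> carrier (tensor_prod R M N)"
  shows "(\<lambda>x. tensor_lift R P (\<phi> x) Y) \<in> linear_maps R L P"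
proof -
  interpret L: module R L by fact
  note lift = tensor_prod_lift_linear[OF assms(2-4) bil]
  note pure = tensor_lift_pure[OF assms(2-4) bil]
  note ext = tensor_prod_ext[OF assms(2-4) _ _ _ Y]
  show ?thesis
  proof (rule linear_mapsI)
    show "tensor_lift R P (\<phi> x) Y \<in> carrier P" if "x \<in> carrier L" for x
      using linear_mapsD(1)[OF lift[OF that] Y] .
    show "tensor_lift R P (\<phi> (x \<oplus>\<^bsub>L\<^esub> y)) Y
        = tensor_lift R P (\<phi> x) Y \<oplus>\<^bsub>P\<^esub> tensor_lift R P (\<phi> y) Y"
      if "x \<in> carrier L" "y \<in> carrier L" for x y
      by (rule ext) (use that in \<open>simp_all add: lift linear_maps_add assms(4) pure linear_mapsD(2)[OF lin]\<close>)
    show "tensor_lift R P (\<phi> (c \<odot>\<^bsub>L\<^esub> x)) Y = c \<odot>\<^bsub>P\<^esub> tensor_lift R P (\<phi> x) Y"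
      if "c \<in> carrier R" "x \<in> carrier L" for c x
      by (rule ext) (use that in \<open>simp_all add: lift linear_maps_smult assms(4) pure linear_mapsD(3)[OF lin]\<close>)
  qed
qed

section \<open>The algebra structure of the tensor product\<close>

context
  fixes R :: "('k, 'r) ring_scheme"
    and A :: "('k, 'a, 'm) module_scheme" and B :: "('k, 'b, 'n) module_scheme"
  assumes A: "unital_algebra R A" and B: "unital_algebra R B"
begin

interpretation A: unital_algebra R A by (rule A)
interpretation B: unital_algebra R B by (rule B)

private abbreviation (input) "T \<equiv> tensor_prod R A B"
private abbreviation (input) "pt \<equiv> pure_tensor R A B"
text \<open>Left multiplication by a \<otimes> b, that is, the inner lift in the definition of the
  product. As in that definition, its target is \<open>tensor_module\<close>.\<close>

private abbreviation (input) "mul a b \<equiv>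
  tensor_lift R (tensor_module R A B) (\<lambda>a' b'. pt (a \<otimes>\<^bsub>A\<^esub> a') (b \<otimes>\<^bsub>B\<^esub> b'))"

interpretation T: module R T
  by (rule tensor_prod_module[OF A.module_axioms B.module_axioms])

private lemmas ptl = pure_tensor_linear[OF A.module_axioms B.module_axioms]
private lemmas ptc = pure_tensor_closed[OF A.module_axioms B.module_axioms]
private lemmas tm = tensor_module_module[OF A.module_axioms B.module_axioms]

private lemma mul_bilinear:
  assumes "a \<in> carrier A" "b \<in> carrier B"
  shows "(\<lambda>a' b'. pt (a \<otimes>\<^bsub>A\<^esub> a') (b \<otimes>\<^bsub>B\<^esub> b')) \<in> bilinear_maps R A B (tensor_module R A B)"
  unfolding linear_maps_tensor_prod(2)[symmetric]
  by (rule bilinear_mapsI)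
    (auto simp: assms linear_maps_tensor_prod(2)[symmetric]
      intro!: linear_maps_compose[OF A.mult_left_linear[OF assms(1)] ptl(2)]
      linear_maps_compose[OF B.mult_left_linear[OF assms(2)] ptl(1)])

private lemma mul_linear:
  assumes "a \<in> carrier A" "b \<in> carrier B"
  shows "mul a b \<in> linear_maps R T T"
  using tensor_prod_lift_linear[OF A.module_axioms B.module_axioms tm mul_bilinear[OF assms]]
  by (simp add: linear_maps_tensor_prod)

text \<open>With the right factor \<open>Y\<close> fixed, this makes the outer lift in the
  definition of the product admissible.\<close>

private lemma mul_linear_param:
  assumes "Y \<in> carrier T"
  shows "(\<lambda>a b. mul a b Y) \<in> bilinear_maps R A B (tensor_module R A B)"
proof (rule bilinear_mapsI)
  show "(\<lambda>b. mul a b Y) \<in> linear_maps R B (tensor_module R A B)" if a: "a \<in> carrier A" for a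
    by (rule tensor_lift_linear_param
        [OF B.module_axioms A.module_axioms B.module_axioms tm _ _ assms])
      (auto simp: a mul_bilinear linear_maps_tensor_prod(2)[symmetric]
        intro!: linear_maps_compose[OF B.mult_right_linear ptl(1)])
  show "(\<lambda>a. mul a b Y) \<in> linear_maps R A (tensor_module R A B)" if b: "b \<in> carrier B" for b
    by (rule tensor_lift_linear_param
        [OF A.module_axioms A.module_axioms B.module_axioms tm _ _ assms])
      (auto simp: b mul_bilinear linear_maps_tensor_prod(2)[symmetric]
        intro!: linear_maps_compose[OF A.mult_right_linear ptl(2)])
qed

private lemma mult_eq:
  "X \<otimes>\<^bsub>T\<^esub> Y = tensor_lift R (tensor_module R A B) (\<lambda>a b. mul a b Y) X"
  by (simp add: tensor_prod_def Let_def)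

text \<open>The product is a lift in its left factor, so linearity in that factor comes directly
  from the universal property.\<close>

private lemma mult_right:
  assumes "Y \<in> carrier T" shows "(\<lambda>X. X \<otimes>\<^bsub>T\<^esub> Y) \<in> linear_maps R T T"
  using tensor_prod_lift_linear[OF A.module_axioms B.module_axioms tm mul_linear_param[OF assms]]
  unfolding mult_eq linear_maps_tensor_prod .

private lemma mult_pure_left:
  assumes "a \<in> carrier A" "b \<in> carrier B" "Y \<in> carrier T"
  shows "pt a b \<otimes>\<^bsub>T\<^esub> Y = mul a b Y"
  unfolding mult_eq
  by (rule tensor_lift_pure[OF A.module_axioms B.module_axioms tm mul_linear_param]) fact+

lemma tensor_prod_mult_pure:
  assumes "a \<in> carrier A" "b \<in> carrier B" "a' \<in> carrier A" "b' \<in> carrier B"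
  shows "pure_tensor R A B a b \<otimes>\<^bsub>tensor_prod R A B\<^esub> pure_tensor R A B a' b'
    = pure_tensor R A B (a \<otimes>\<^bsub>A\<^esub> a') (b \<otimes>\<^bsub>B\<^esub> b')"
  using assms
  by (simp add: mult_pure_left ptc tensor_lift_pure
      [OF A.module_axioms B.module_axioms tm mul_bilinear])

private lemmas ext = tensor_prod_ext[OF A.module_axioms B.module_axioms T.module_axioms]

private lemma mult_closed:
  "X \<in> carrier T \<Longrightarrow> Y \<in> carrier T \<Longrightarrow> X \<otimes>\<^bsub>T\<^esub> Y \<in> carrier T"
  using linear_mapsD(1)[OF mult_right] .

text \<open>The right factor is hidden in the inner lift. Both sides of each law are linear in
  \<open>X\<close> by \<open>mult_right\<close>, so \<open>X\<close> may be taken pure, and then the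
  product is \<open>mul\<close>, which is linear.\<close>

private lemma mult_left:
  assumes X: "X \<in> carrier T" shows "(\<lambda>Y. X \<otimes>\<^bsub>T\<^esub> Y) \<in> linear_maps R T T"
proof (rule linear_mapsI)
  show "X \<otimes>\<^bsub>T\<^esub> Y \<in> carrier T" if "Y \<in> carrier T" for Y
    using mult_closed[OF X that] .
  show "X \<otimes>\<^bsub>T\<^esub> (Y \<oplus>\<^bsub>T\<^esub> Z) = X \<otimes>\<^bsub>T\<^esub> Y \<oplus>\<^bsub>T\<^esub> X \<otimes>\<^bsub>T\<^esub> Z" if "Y \<in> carrier T" "Z \<in> carrier T" for Y Z
    by (rule ext[OF mult_right linear_maps_add[OF T.module_axioms mult_right mult_right] _ X])
      (use that in \<open>simp_all add: mult_pure_left linear_mapsD(2)[OF mul_linear]\<close>)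
  show "X \<otimes>\<^bsub>T\<^esub> (c \<odot>\<^bsub>T\<^esub> Y) = c \<odot>\<^bsub>T\<^esub> (X \<otimes>\<^bsub>T\<^esub> Y)" if "c \<in> carrier R" "Y \<in> carrier T" for c Y
    by (rule ext[OF mult_right linear_maps_smult[OF T.module_axioms mult_right] _ X])
      (use that in \<open>simp_all add: mult_pure_left linear_mapsD(3)[OF mul_linear]\<close>)
qed

text \<open>The factors \<open>X\<close>, \<open>Y\<close>, \<open>Z\<close> are replaced by pure
  tensors one after the other, with linearity supplied by \<open>mult_left\<close> and
  \<open>mult_right\<close>; what remains is associativity in \<open>A\<close> and in
  \<open>B\<close>.\<close>

private lemma mult_assoc:
  assumes X: "X \<in> carrier T" and Y: "Y \<in> carrier T" and Z: "Z \<in> carrier T"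
  shows "(X \<otimes>\<^bsub>T\<^esub> Y) \<otimes>\<^bsub>T\<^esub> Z = X \<otimes>\<^bsub>T\<^esub> (Y \<otimes>\<^bsub>T\<^esub> Z)"
proof (rule ext[OF linear_maps_compose[OF mult_right[OF Y] mult_right[OF Z]]
      mult_right[OF mult_closed[OF Y Z]] _ X])
  fix a b assume ab: "a \<in> carrier A" "b \<in> carrier B"
  show "(pt a b \<otimes>\<^bsub>T\<^esub> Y) \<otimes>\<^bsub>T\<^esub> Z = pt a b \<otimes>\<^bsub>T\<^esub> (Y \<otimes>\<^bsub>T\<^esub> Z)"
  proof (rule ext[OF linear_maps_compose[OF mult_left mult_right[OF Z]]
        linear_maps_compose[OF mult_right[OF Z] mult_left] _ Y])
    fix a' b' assume ab': "a' \<in> carrier A" "b' \<in> carrier B"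
    show "(pt a b \<otimes>\<^bsub>T\<^esub> pt a' b') \<otimes>\<^bsub>T\<^esub> Z = pt a b \<otimes>\<^bsub>T\<^esub> (pt a' b' \<otimes>\<^bsub>T\<^esub> Z)"
      by (rule ext[OF mult_left linear_maps_compose[OF mult_left mult_left] _ Z])
        (use ab ab' in \<open>simp_all add: tensor_prod_mult_pure ptc mult_closed A.m_assoc B.m_assoc\<close>)
  qed (use ab in \<open>simp_all add: ptc\<close>)
qed

lemma tensor_prod_one: "\<one>\<^bsub>tensor_prod R A B\<^esub> = pure_tensor R A B \<one>\<^bsub>A\<^esub> \<one>\<^bsub>B\<^esub>"
  by (simp add: tensor_prod_def Let_def)

lemma unital_algebra_tensor_prod: "unital_algebra R (tensor_prod R A B)"
proof -
  have one: "\<one>\<^bsub>T\<^esub> \<in> carrier T" by (simp add: tensor_prod_one ptc)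
  have "\<one>\<^bsub>T\<^esub> \<otimes>\<^bsub>T\<^esub> X = X" if "X \<in> carrier T" for X
    by (rule ext[OF mult_left[OF one] linear_maps_id _ that])
      (simp add: tensor_prod_one tensor_prod_mult_pure)
  moreover have "X \<otimes>\<^bsub>T\<^esub> \<one>\<^bsub>T\<^esub> = X" if "X \<in> carrier T" for X
    by (rule ext[OF mult_right[OF one] linear_maps_id _ that])
      (simp add: tensor_prod_one tensor_prod_mult_pure)
  ultimately have "Group.monoid T"
    by (intro Group.monoidI one mult_closed mult_assoc)
  then have "ring T"
    by (intro ringI T.abelian_group_axioms)
      (simp_all add: linear_mapsD(2)[OF mult_left] linear_mapsD(2)[OF mult_right])
  with T.module_axioms show ?thesis
    by (intro unital_algebra.intro unital_algebra_axioms.intro)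
      (simp_all add: linear_mapsD(3)[OF mult_left] linear_mapsD(3)[OF mult_right])
qed

end

text \<open>Both sides of the conclusion are bilinear in \<open>X\<close> and \<open>Y\<close>, so
  two passages to pure tensors reduce it to the assumption \<open>pure\<close>. It will be applied
  to the legs.\<close>

lemma tensor_prod_mult_hom:
  assumes A: "unital_algebra R A" and B: "unital_algebra R B" and C: "unital_algebra R C"
    and h: "h \<in> linear_maps R (tensor_prod R A B) C"
    and pure: "\<And>a b a' b'. a \<in> carrier A \<Longrightarrow> b \<in> carrier B \<Longrightarrow> a' \<in> carrier A \<Longrightarrow> b' \<in> carrier B \<Longrightarrow>
      h (pure_tensor R A B (a \<otimes>\<^bsub>A\<^esub> a') (b \<otimes>\<^bsub>B\<^esub> b'))
        = h (pure_tensor R A B a b) \<otimes>\<^bsub>C\<^esub> h (pure_tensor R A B a' b')"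
    and X: "X \<in> carrier (tensor_prod R A B)" and Y: "Y \<in> carrier (tensor_prod R A B)"
  shows "h (X \<otimes>\<^bsub>tensor_prod R A B\<^esub> Y) = h X \<otimes>\<^bsub>C\<^esub> h Y"
proof -
  interpret A: unital_algebra R A by fact
  interpret B: unital_algebra R B by fact
  interpret C: unital_algebra R C by fact
  interpret T: unital_algebra R "tensor_prod R A B" by (rule unital_algebra_tensor_prod) fact+
  note ext = tensor_prod_ext[OF A.module_axioms B.module_axioms C.module_axioms]
  note ptc = pure_tensor_closed[OF A.module_axioms B.module_axioms]
  show ?thesis
  proof (rule ext[OF linear_maps_compose[OF T.mult_right_linear[OF Y] h]
        linear_maps_compose[OF h C.mult_right_linear] _ X])
    fix a b assume ab: "a \<in> carrier A" "b \<in> carrier B"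
    show "h (pure_tensor R A B a b \<otimes>\<^bsub>tensor_prod R A B\<^esub> Y) = h (pure_tensor R A B a b) \<otimes>\<^bsub>C\<^esub> h Y"
      by (rule ext[OF linear_maps_compose[OF T.mult_left_linear h]
            linear_maps_compose[OF h C.mult_left_linear] _ Y])
        (use ab in \<open>simp_all add: ptc linear_mapsD(1)[OF h] tensor_prod_mult_pure[OF A B] pure\<close>)
  qed (rule linear_mapsD(1)[OF h Y])
qed


section \<open>Legs and the induced comultiplication\<close>

text \<open>Here \<open>p\<close>, \<open>q\<close>, \<open>s\<close> are \<open>r\<^sub>1\<^sub>2\<close>, \<open>r\<^sub>1\<^sub>3\<close>, \<open>r\<^sub>2\<^sub>3\<close>, and \<open>u\<close>, \<open>w\<close>, \<open>v\<close> are the same legs of \<open>\<Delta> a\<close>.\<close>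

lemma (in unital_algebra) aybe_identity:
  assumes car: "e\<^sub>1 \<in> carrier A" "e\<^sub>2 \<in> carrier A" "e\<^sub>3 \<in> carrier A" "p \<in> carrier A" "q \<in> carrier A"
      "s \<in> carrier A" "l \<in> carrier R"
    and aybe: "((q \<otimes>\<^bsub>A\<^esub> p) \<ominus>\<^bsub>A\<^esub> (p \<otimes>\<^bsub>A\<^esub> s)) \<oplus>\<^bsub>A\<^esub> (s \<otimes>\<^bsub>A\<^esub> q) = l \<odot>\<^bsub>A\<^esub> q"
    and comm: "e\<^sub>3 \<otimes>\<^bsub>A\<^esub> p = p \<otimes>\<^bsub>A\<^esub> e\<^sub>3" "s \<otimes>\<^bsub>A\<^esub> e\<^sub>1 = e\<^sub>1 \<otimes>\<^bsub>A\<^esub> s"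
    and u: "u = (e\<^sub>1 \<otimes>\<^bsub>A\<^esub> p \<ominus>\<^bsub>A\<^esub> p \<otimes>\<^bsub>A\<^esub> e\<^sub>2) \<ominus>\<^bsub>A\<^esub> l \<odot>\<^bsub>A\<^esub> e\<^sub>1"
    and w: "w = (e\<^sub>1 \<otimes>\<^bsub>A\<^esub> q \<ominus>\<^bsub>A\<^esub> q \<otimes>\<^bsub>A\<^esub> e\<^sub>3) \<ominus>\<^bsub>A\<^esub> l \<odot>\<^bsub>A\<^esub> e\<^sub>1"
    and v: "v = (e\<^sub>2 \<otimes>\<^bsub>A\<^esub> s \<ominus>\<^bsub>A\<^esub> s \<otimes>\<^bsub>A\<^esub> e\<^sub>3) \<ominus>\<^bsub>A\<^esub> l \<odot>\<^bsub>A\<^esub> e\<^sub>2"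
  shows "(w \<otimes>\<^bsub>A\<^esub> p \<ominus>\<^bsub>A\<^esub> p \<otimes>\<^bsub>A\<^esub> v) \<ominus>\<^bsub>A\<^esub> l \<odot>\<^bsub>A\<^esub> w = (u \<otimes>\<^bsub>A\<^esub> s \<ominus>\<^bsub>A\<^esub> s \<otimes>\<^bsub>A\<^esub> w) \<ominus>\<^bsub>A\<^esub> l \<odot>\<^bsub>A\<^esub> u"
proof -
  \<comment> \<open>Solves the Yang-Baxter equation for the product of \<open>q\<close> and
    \<open>p\<close>, so that it can serve as a rewrite rule.\<close>
  have "q \<otimes>\<^bsub>A\<^esub> p = (((q \<otimes>\<^bsub>A\<^esub> p) \<ominus>\<^bsub>A\<^esub> (p \<otimes>\<^bsub>A\<^esub> s)) \<oplus>\<^bsub>A\<^esub> (s \<otimes>\<^bsub>A\<^esub> q)) \<oplus>\<^bsub>A\<^esub> (p \<otimes>\<^bsub>A\<^esub> s \<ominus>\<^bsub>A\<^esub> s \<otimes>\<^bsub>A\<^esub> q)"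
    using car by (simp add: A.ring_simprules r_neg)
  then have qp: "q \<otimes>\<^bsub>A\<^esub> p = l \<odot>\<^bsub>A\<^esub> q \<oplus>\<^bsub>A\<^esub> (p \<otimes>\<^bsub>A\<^esub> s \<ominus>\<^bsub>A\<^esub> s \<otimes>\<^bsub>A\<^esub> q)"
    unfolding aybe .
  \<comment> \<open>Products are normalised to the right, which hides the factor \<open>q p\<close>
    in \<open>q (p e\<^sub>3)\<close>; this instance exposes it again. The next fact extends the
    commutation of \<open>s\<close> and \<open>e\<^sub>1\<close> to longer products for the same
    reason.\<close>
  have qpe: "q \<otimes>\<^bsub>A\<^esub> (p \<otimes>\<^bsub>A\<^esub> e\<^sub>3) = (q \<otimes>\<^bsub>A\<^esub> p) \<otimes>\<^bsub>A\<^esub> e\<^sub>3"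
    using car by (simp add: A.m_assoc)
  have se: "s \<otimes>\<^bsub>A\<^esub> (e\<^sub>1 \<otimes>\<^bsub>A\<^esub> z) = e\<^sub>1 \<otimes>\<^bsub>A\<^esub> (s \<otimes>\<^bsub>A\<^esub> z)" if "z \<in> carrier A" for z
    using car that comm(2) by (simp add: A.m_assoc[symmetric])
  \<comment> \<open>The monomials that cancel: after elimination of \<open>q p\<close>, the
    left-hand side contains each \<open>?x\<^sub>i\<close> with both signs, and the right-hand side
    does so with \<open>?y\<close>.\<close>
  let ?x\<^sub>1 = "p \<otimes>\<^bsub>A\<^esub> (s \<otimes>\<^bsub>A\<^esub> e\<^sub>3)" and ?x\<^sub>2 = "l \<odot>\<^bsub>A\<^esub> (e\<^sub>1 \<otimes>\<^bsub>A\<^esub> q)" and ?x\<^sub>3 = "l \<odot>\<^bsub>A\<^esub> (q \<otimes>\<^bsub>A\<^esub> e\<^sub>3)"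
    and ?y = "l \<odot>\<^bsub>A\<^esub> (e\<^sub>1 \<otimes>\<^bsub>A\<^esub> s)"
  have c: "u \<in> carrier A" "v \<in> carrier A" "w \<in> carrier A"
    using car by (simp_all add: u v w)
  \<comment> \<open>With the cancelling pairs added, both sides expand to the same sum up to reordering, so that
    the simplifier need not find the pairs among the summands.\<close>
  have "((w \<otimes>\<^bsub>A\<^esub> p \<ominus>\<^bsub>A\<^esub> p \<otimes>\<^bsub>A\<^esub> v) \<ominus>\<^bsub>A\<^esub> l \<odot>\<^bsub>A\<^esub> w) \<oplus>\<^bsub>A\<^esub> (?y \<oplus>\<^bsub>A\<^esub> \<ominus>\<^bsub>A\<^esub> ?y) =
    ((u \<otimes>\<^bsub>A\<^esub> s \<ominus>\<^bsub>A\<^esub> s \<otimes>\<^bsub>A\<^esub> w) \<ominus>\<^bsub>A\<^esub> l \<odot>\<^bsub>A\<^esub> u)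
      \<oplus>\<^bsub>A\<^esub> ((?x\<^sub>1 \<oplus>\<^bsub>A\<^esub> \<ominus>\<^bsub>A\<^esub> ?x\<^sub>1) \<oplus>\<^bsub>A\<^esub> ((?x\<^sub>2 \<oplus>\<^bsub>A\<^esub> \<ominus>\<^bsub>A\<^esub> ?x\<^sub>2) \<oplus>\<^bsub>A\<^esub> (?x\<^sub>3 \<oplus>\<^bsub>A\<^esub> \<ominus>\<^bsub>A\<^esub> ?x\<^sub>3)))"
    unfolding u v w using car
    by (simp add: a_minus_def A.l_distr A.r_distr A.l_minus A.r_minus minus_add A.m_assoc
      smult_mult_left smult_mult_right smult_r_distr smult_r_minus comm qpe qp se a_ac)
  then show ?thesis
    using car c by (simp add: r_neg)
qed

section \<open>Legs and actions as products in the tensor algebras\<close>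

context
  fixes R :: "('k, 'r) ring_scheme" and A :: "('k, 'a, 'm) module_scheme"
  assumes A: "unital_algebra R A"
begin

interpretation A: unital_algebra R A by (rule A)

private abbreviation (input) "T2 \<equiv> tensor2 R A"
private abbreviation (input) "T3 \<equiv> tensor3 R A"
private abbreviation (input) "pt2 \<equiv> pure_tensor R A A"
private abbreviation (input) "pt3 \<equiv> pure_tensor3 R A"

interpretation T2: unital_algebra R T2
  by (rule unital_algebra_tensor_prod[OF A A])
interpretation T3: unital_algebra R T3
  by (rule unital_algebra_tensor_prod[OF T2.unital_algebra_axioms A])

private lemmas pt2_linear = pure_tensor_linear[OF A.module_axioms A.module_axioms]
private lemmas pt2_closed = pure_tensor_closed[OF A.module_axioms A.module_axioms]
private lemmas pt3_linear = pure_tensor_linear[OF T2.module_axioms A.module_axioms]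
private lemmas pt3_closed = pure_tensor_closed[OF T2.module_axioms A.module_axioms]
private lemmas pt_mult = tensor_prod_mult_pure[OF A A]

lemma pure_tensor3_closed:
  assumes "x \<in> carrier A" "y \<in> carrier A" "z \<in> carrier A"
  shows "pure_tensor3 R A x y z \<in> carrier (tensor3 R A)"
  using assms by (simp add: pure_tensor3_def pt2_closed pt3_closed)

lemma pure_tensor3_linear:
  shows "y \<in> carrier A \<Longrightarrow> z \<in> carrier A \<Longrightarrow> (\<lambda>x. pure_tensor3 R A x y z) \<in> linear_maps R A (tensor3 R A)"
    and "x \<in> carrier A \<Longrightarrow> z \<in> carrier A \<Longrightarrow> (\<lambda>y. pure_tensor3 R A x y z) \<in> linear_maps R A (tensor3 R A)"
    and "x \<in> carrier A \<Longrightarrow> y \<in> carrier A \<Longrightarrow> (\<lambda>z. pure_tensor3 R A x y z) \<in> linear_maps R A (tensor3 R A)"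
  unfolding pure_tensor3_def
  by (intro linear_maps_compose[OF pt2_linear(2) pt3_linear(2)] linear_maps_compose[OF pt2_linear(1) pt3_linear(2)]
      pt3_linear(1) pt2_closed; assumption)+

lemma pure_tensor3_mult:
  assumes "x \<in> carrier A" "y \<in> carrier A" "z \<in> carrier A"
    "x' \<in> carrier A" "y' \<in> carrier A" "z' \<in> carrier A"
  shows "pure_tensor3 R A x y z \<otimes>\<^bsub>tensor3 R A\<^esub> pure_tensor3 R A x' y' z'
    = pure_tensor3 R A (x \<otimes>\<^bsub>A\<^esub> x') (y \<otimes>\<^bsub>A\<^esub> y') (z \<otimes>\<^bsub>A\<^esub> z')"
  using assms
  by (simp add: pure_tensor3_def pt2_closed pt_mult tensor_prod_mult_pure[OF T2.unital_algebra_axioms A])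

private lemma leg_bilinear:
  "(\<lambda>u v. pt3 u v \<one>\<^bsub>A\<^esub>) \<in> bilinear_maps R A A T3"
  "(\<lambda>u v. pt3 u \<one>\<^bsub>A\<^esub> v) \<in> bilinear_maps R A A T3"
  "(\<lambda>u v. pt3 \<one>\<^bsub>A\<^esub> u v) \<in> bilinear_maps R A A T3"
  by (intro bilinear_mapsI pure_tensor3_linear A.one_closed; assumption)+

private lemmas lift_linear =
  tensor_prod_lift_linear[OF A.module_axioms A.module_axioms T3.module_axioms]
private lemmas lift_pure =
  tensor_lift_pure[OF A.module_axioms A.module_axioms T3.module_axioms]
private lemmas ext2 = tensor_prod_ext[OF A.module_axioms A.module_axioms T2.module_axioms]
private lemmas ext3 = tensor_prod_ext[OF A.module_axioms A.module_axioms T3.module_axioms]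

lemma leg_linear:
  "leg12 R A \<in> linear_maps R (tensor2 R A) (tensor3 R A)"
  "leg13 R A \<in> linear_maps R (tensor2 R A) (tensor3 R A)"
  "leg23 R A \<in> linear_maps R (tensor2 R A) (tensor3 R A)"
  unfolding leg12_def leg13_def leg23_def
  by (intro lift_linear leg_bilinear)+

lemma leg_pure:
  assumes "u \<in> carrier A" "v \<in> carrier A"
  shows "leg12 R A (pure_tensor R A A u v) = pure_tensor3 R A u v \<one>\<^bsub>A\<^esub>"
    and "leg13 R A (pure_tensor R A A u v) = pure_tensor3 R A u \<one>\<^bsub>A\<^esub> v"
    and "leg23 R A (pure_tensor R A A u v) = pure_tensor3 R A \<one>\<^bsub>A\<^esub> u v"
  unfolding leg12_def leg13_def leg23_def
  by (rule lift_pure; intro leg_bilinear assms)+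

text \<open>A leg fills the free slot with the unit, which is idempotent, so it is multiplicative on
  pure tensors; \<open>tensor_prod_mult_hom\<close> does the rest.\<close>

lemma leg_mult:
  assumes "X \<in> carrier (tensor2 R A)" "Y \<in> carrier (tensor2 R A)"
  shows "leg12 R A (X \<otimes>\<^bsub>tensor2 R A\<^esub> Y) = leg12 R A X \<otimes>\<^bsub>tensor3 R A\<^esub> leg12 R A Y"
    and "leg13 R A (X \<otimes>\<^bsub>tensor2 R A\<^esub> Y) = leg13 R A X \<otimes>\<^bsub>tensor3 R A\<^esub> leg13 R A Y"
    and "leg23 R A (X \<otimes>\<^bsub>tensor2 R A\<^esub> Y) = leg23 R A X \<otimes>\<^bsub>tensor3 R A\<^esub> leg23 R A Y"
  by (rule tensor_prod_mult_hom[OF A A T3.unital_algebra_axioms leg_linear(1) _ assms]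
      tensor_prod_mult_hom[OF A A T3.unital_algebra_axioms leg_linear(2) _ assms]
      tensor_prod_mult_hom[OF A A T3.unital_algebra_axioms leg_linear(3) _ assms];
      simp add: leg_pure pure_tensor3_mult)+

text \<open>Both sides are linear in \<open>X\<close> and agree on pure tensors. As a product in A
  \<otimes> A the action becomes accessible to the ring laws and to the legs;
  \<open>right_act_eq_mult\<close> serves the other side.\<close>

lemma left_act_eq_mult:
  assumes "a \<in> carrier A" "X \<in> carrier (tensor2 R A)"
  shows "left_act R A a X = pure_tensor R A A a \<one>\<^bsub>A\<^esub> \<otimes>\<^bsub>tensor2 R A\<^esub> X"
proof -
  have bil: "(\<lambda>b c. pt2 (a \<otimes>\<^bsub>A\<^esub> b) c) \<in> bilinear_maps R A A T2"
    by (intro bilinear_mapsI pt2_linear(1) linear_maps_compose[OF A.mult_left_linear pt2_linear(2)])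
      (simp_all add: assms)
  show ?thesis
    unfolding left_act_def
    by (rule ext2[OF tensor_prod_lift_linear[OF A.module_axioms A.module_axioms T2.module_axioms bil]
          T2.mult_left_linear _ assms(2)])
      (simp_all add: assms pt2_closed pt_mult
        tensor_lift_pure[OF A.module_axioms A.module_axioms T2.module_axioms bil])
qed

lemma right_act_eq_mult:
  assumes "a \<in> carrier A" "X \<in> carrier (tensor2 R A)"
  shows "right_act R A X a = X \<otimes>\<^bsub>tensor2 R A\<^esub> pure_tensor R A A \<one>\<^bsub>A\<^esub> a"
proof -
  have bil: "(\<lambda>b c. pt2 b (c \<otimes>\<^bsub>A\<^esub> a)) \<in> bilinear_maps R A A T2"
    by (intro bilinear_mapsI pt2_linear(2) linear_maps_compose[OF A.mult_right_linear pt2_linear(1)])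
      (simp_all add: assms)
  show ?thesis
    unfolding right_act_def
    by (rule ext2[OF tensor_prod_lift_linear[OF A.module_axioms A.module_axioms T2.module_axioms bil]
          T2.mult_right_linear _ assms(2)])
      (simp_all add: assms pt2_closed pt_mult
        tensor_lift_pure[OF A.module_axioms A.module_axioms T2.module_axioms bil])
qed

text \<open>The two factors occupy disjoint slots: for X = u \<otimes> v both products are u
  \<otimes> v \<otimes> a in the first case and a \<otimes> u \<otimes> v in the second.\<close>

lemma leg_commute:
  assumes "a \<in> carrier A" "X \<in> carrier (tensor2 R A)"
  shows "pure_tensor3 R A \<one>\<^bsub>A\<^esub> \<one>\<^bsub>A\<^esub> a \<otimes>\<^bsub>tensor3 R A\<^esub> leg12 R A X
      = leg12 R A X \<otimes>\<^bsub>tensor3 R A\<^esub> pure_tensor3 R A \<one>\<^bsub>A\<^esub> \<one>\<^bsub>A\<^esub> a"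
    and "leg23 R A X \<otimes>\<^bsub>tensor3 R A\<^esub> pure_tensor3 R A a \<one>\<^bsub>A\<^esub> \<one>\<^bsub>A\<^esub>
      = pure_tensor3 R A a \<one>\<^bsub>A\<^esub> \<one>\<^bsub>A\<^esub> \<otimes>\<^bsub>tensor3 R A\<^esub> leg23 R A X"
proof -
  have c: "pt3 \<one>\<^bsub>A\<^esub> \<one>\<^bsub>A\<^esub> a \<in> carrier T3" "pt3 a \<one>\<^bsub>A\<^esub> \<one>\<^bsub>A\<^esub> \<in> carrier T3"
    using assms(1) by (simp_all add: pure_tensor3_closed)
  show "pt3 \<one>\<^bsub>A\<^esub> \<one>\<^bsub>A\<^esub> a \<otimes>\<^bsub>T3\<^esub> leg12 R A X = leg12 R A X \<otimes>\<^bsub>T3\<^esub> pt3 \<one>\<^bsub>A\<^esub> \<one>\<^bsub>A\<^esub> a"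
    by (rule ext3[OF linear_maps_compose[OF leg_linear(1) T3.mult_left_linear[OF c(1)]]
          linear_maps_compose[OF leg_linear(1) T3.mult_right_linear[OF c(1)]] _ assms(2)])
      (simp add: leg_pure pure_tensor3_mult assms(1))
  show "leg23 R A X \<otimes>\<^bsub>T3\<^esub> pt3 a \<one>\<^bsub>A\<^esub> \<one>\<^bsub>A\<^esub> = pt3 a \<one>\<^bsub>A\<^esub> \<one>\<^bsub>A\<^esub> \<otimes>\<^bsub>T3\<^esub> leg23 R A X"
    by (rule ext3[OF linear_maps_compose[OF leg_linear(3) T3.mult_right_linear[OF c(2)]]
          linear_maps_compose[OF leg_linear(3) T3.mult_left_linear[OF c(2)]] _ assms(2)])
      (simp add: leg_pure pure_tensor3_mult assms(1))
qed

text \<open>Splits \<Delta> x \<otimes> y into a product of a leg of \<Delta> x and an element of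
  the third slot.\<close>

lemma pure_tensor_leg12:
  assumes "X \<in> carrier (tensor2 R A)" "a \<in> carrier A"
  shows "pure_tensor R (tensor2 R A) A X a
    = leg12 R A X \<otimes>\<^bsub>tensor3 R A\<^esub> pure_tensor3 R A \<one>\<^bsub>A\<^esub> \<one>\<^bsub>A\<^esub> a"
  by (rule ext3[OF pt3_linear(2) linear_maps_compose[OF leg_linear(1) T3.mult_right_linear] _ assms(1)])
    (simp_all add: leg_pure pure_tensor3_mult pure_tensor3_closed assms(2),
      simp add: pure_tensor3_def)

section \<open>Reassociation of threefold tensors\<close>

private lemma assoc_bilinear:
  "(\<lambda>m n. pure_tensor R T2 A (pt2 x m) n) \<in> bilinear_maps R A A T3" if "x \<in> carrier A"
  unfolding pure_tensor3_def[symmetric]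
  by (intro bilinear_mapsI pure_tensor3_linear that; assumption)

text \<open>The inner lift depends linearly on \<open>x\<close> by
  \<open>tensor_lift_linear_param\<close>, as the outer lift in \<open>tensor_assoc\<close>
  requires.\<close>

private lemma assoc_bilinear':
  "(\<lambda>x. tensor_lift R T3 (\<lambda>m n. pure_tensor R T2 A (pt2 x m) n)) \<in> bilinear_maps R A T2 T3"
  by (intro bilinear_mapsI lift_linear assoc_bilinear tensor_lift_linear_param
      [OF A.module_axioms A.module_axioms A.module_axioms T3.module_axioms];
      (assumption | simp add: pure_tensor3_def[symmetric] pure_tensor3_linear))

lemma tensor_assoc_linear:
  "tensor_assoc R A A A \<in> linear_maps R (tensor_prod R A (tensor2 R A)) (tensor3 R A)"
  unfolding tensor_assoc_def Let_def
  by (rule tensor_prod_lift_linear[OF A.module_axioms T2.module_axioms T3.module_axioms assoc_bilinear'])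

text \<open>Mirror image of \<open>pure_tensor_leg12\<close>, for use with x \<otimes> \<Delta> y.
  The outer lift is evaluated at once, the inner one after a passage to pure tensors in
  \<open>X\<close>.\<close>

lemma tensor_assoc_pure:
  assumes "a \<in> carrier A" "X \<in> carrier (tensor2 R A)"
  shows "tensor_assoc R A A A (pure_tensor R A (tensor2 R A) a X)
    = pure_tensor3 R A a \<one>\<^bsub>A\<^esub> \<one>\<^bsub>A\<^esub> \<otimes>\<^bsub>tensor3 R A\<^esub> leg23 R A X"
proof -
  have "tensor_assoc R A A A (pure_tensor R A T2 a X)
      = tensor_lift R T3 (\<lambda>m n. pure_tensor R T2 A (pt2 a m) n) X"
    unfolding tensor_assoc_def Let_def
    by (rule tensor_lift_pure[OF A.module_axioms T2.module_axioms T3.module_axioms assoc_bilinear' assms])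
  also have "\<dots> = pt3 a \<one>\<^bsub>A\<^esub> \<one>\<^bsub>A\<^esub> \<otimes>\<^bsub>T3\<^esub> leg23 R A X"
    by (rule ext3[OF lift_linear[OF assoc_bilinear[OF assms(1)]]
          linear_maps_compose[OF leg_linear(3) T3.mult_left_linear] _ assms(2)])
      (simp_all add: lift_pure[OF assoc_bilinear] leg_pure pure_tensor3_mult pure_tensor3_closed assms(1),
        simp add: pure_tensor3_def)
  finally show ?thesis .
qed

section \<open>The comultiplication defined by r\<close>

context
  fixes l r
  assumes l: "l \<in> carrier R" and r: "r \<in> carrier (tensor2 R A)"
begin

private abbreviation (input) "\<Delta> \<equiv> comult_of R A l r"

text \<open>From here on \<Delta> is an expression in the ring A \<otimes> A, into which
  \<open>a\<close> enters through a \<otimes> 1 and 1 \<otimes> a.\<close>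

private lemma \<Delta>_eq:
  assumes "a \<in> carrier A"
  shows "\<Delta> a = (pt2 a \<one>\<^bsub>A\<^esub> \<otimes>\<^bsub>T2\<^esub> r \<ominus>\<^bsub>T2\<^esub> r \<otimes>\<^bsub>T2\<^esub> pt2 \<one>\<^bsub>A\<^esub> a) \<ominus>\<^bsub>T2\<^esub> l \<odot>\<^bsub>T2\<^esub> pt2 a \<one>\<^bsub>A\<^esub>"
  using assms r by (simp add: comult_of_def left_act_eq_mult right_act_eq_mult)

lemma comult_of_linear: "comult_of R A l r \<in> linear_maps R A (tensor2 R A)"
proof -
  have "(\<lambda>a. (pt2 a \<one>\<^bsub>A\<^esub> \<otimes>\<^bsub>T2\<^esub> r \<ominus>\<^bsub>T2\<^esub> r \<otimes>\<^bsub>T2\<^esub> pt2 \<one>\<^bsub>A\<^esub> a) \<ominus>\<^bsub>T2\<^esub> l \<odot>\<^bsub>T2\<^esub> pt2 a \<one>\<^bsub>A\<^esub>)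
      \<in> linear_maps R A T2"
    by (intro linear_maps_minus linear_maps_smult T2.module_axioms l pt2_linear A.one_closed
        linear_maps_compose[OF pt2_linear(2) T2.mult_right_linear]
        linear_maps_compose[OF pt2_linear(1) T2.mult_left_linear] r)
  \<comment> \<open>\<open>\<Delta>_eq\<close> holds on the carrier, and linearity is tested only
    there.\<close>
  then show ?thesis by (simp add: linear_maps_def \<Delta>_eq Pi_def)
qed

private lemmas \<Delta>_closed = linear_mapsD(1)[OF comult_of_linear]

text \<open>A leg is linear and multiplicative, so it can be applied termwise to
  \<open>\<Delta>_eq\<close>. Quantifying over the three legs lets one proof serve them all.\<close>

lemma leg_comult_of:
  assumes "leg \<in> {leg12 R A, leg13 R A, leg23 R A}" "a \<in> carrier A"
  shows "leg (comult_of R A l r a)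
    = (leg (pure_tensor R A A a \<one>\<^bsub>A\<^esub>) \<otimes>\<^bsub>tensor3 R A\<^esub> leg r
        \<ominus>\<^bsub>tensor3 R A\<^esub> leg r \<otimes>\<^bsub>tensor3 R A\<^esub> leg (pure_tensor R A A \<one>\<^bsub>A\<^esub> a))
      \<ominus>\<^bsub>tensor3 R A\<^esub> l \<odot>\<^bsub>tensor3 R A\<^esub> leg (pure_tensor R A A a \<one>\<^bsub>A\<^esub>)"
proof -
  have lin: "leg \<in> linear_maps R T2 T3" using assms(1) leg_linear by auto
  have mult: "leg (X \<otimes>\<^bsub>T2\<^esub> Y) = leg X \<otimes>\<^bsub>T3\<^esub> leg Y" if "X \<in> carrier T2" "Y \<in> carrier T2" for X Y
    using assms(1) leg_mult[OF that] by auto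
  show ?thesis
    using assms(2) l r
    by (simp add: \<Delta>_eq pt2_closed mult linear_mapsD(3)[OF lin]
        linear_map_minus[OF T2.module_axioms T3.module_axioms lin])
qed

text \<open>With both actions written as products this is a computation in A \<otimes> A: the mixed
  terms (a \<otimes> 1) r (1 \<otimes> b) cancel, and the weight term coming from \<Delta> a cancels
  the summand l (a \<otimes> b).\<close>

lemma comult_of_mult:
  assumes "a \<in> carrier A" "b \<in> carrier A"
  shows "comult_of R A l r (a \<otimes>\<^bsub>A\<^esub> b) =
        (left_act R A a (comult_of R A l r b) \<oplus>\<^bsub>tensor2 R A\<^esub> right_act R A (comult_of R A l r a) b)
          \<oplus>\<^bsub>tensor2 R A\<^esub> l \<odot>\<^bsub>tensor2 R A\<^esub> pure_tensor R A A a b"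
proof -
  let ?i = "\<lambda>a. pt2 a \<one>\<^bsub>A\<^esub>" and ?j = "\<lambda>a. pt2 \<one>\<^bsub>A\<^esub> a"
  have m: "?i (a \<otimes>\<^bsub>A\<^esub> b) = ?i a \<otimes>\<^bsub>T2\<^esub> ?i b" "?j (a \<otimes>\<^bsub>A\<^esub> b) = ?j a \<otimes>\<^bsub>T2\<^esub> ?j b"
      "pt2 a b = ?i a \<otimes>\<^bsub>T2\<^esub> ?j b"
    using assms by (simp_all add: pt_mult)
  have c: "?i a \<in> carrier T2" "?i b \<in> carrier T2" "?j a \<in> carrier T2" "?j b \<in> carrier T2"
    using assms by (simp_all add: pt2_closed)
  have L: "left_act R A a (\<Delta> b) = ?i a \<otimes>\<^bsub>T2\<^esub> \<Delta> b" "right_act R A (\<Delta> a) b = \<Delta> a \<otimes>\<^bsub>T2\<^esub> ?j b"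
    using assms by (simp_all add: left_act_eq_mult right_act_eq_mult \<Delta>_closed)
  \<comment> \<open>The two terms that cancel on the right-hand side; adding each with its negative
    on the left makes both sides expand to the same sum.\<close>
  let ?x = "?i a \<otimes>\<^bsub>T2\<^esub> (r \<otimes>\<^bsub>T2\<^esub> ?j b)" and ?y = "l \<odot>\<^bsub>T2\<^esub> (?i a \<otimes>\<^bsub>T2\<^esub> ?j b)"
  have "\<Delta> (a \<otimes>\<^bsub>A\<^esub> b) \<oplus>\<^bsub>T2\<^esub> ((?x \<oplus>\<^bsub>T2\<^esub> \<ominus>\<^bsub>T2\<^esub> ?x) \<oplus>\<^bsub>T2\<^esub> (?y \<oplus>\<^bsub>T2\<^esub> \<ominus>\<^bsub>T2\<^esub> ?y)) =
      (?i a \<otimes>\<^bsub>T2\<^esub> \<Delta> b \<oplus>\<^bsub>T2\<^esub> \<Delta> a \<otimes>\<^bsub>T2\<^esub> ?j b) \<oplus>\<^bsub>T2\<^esub> ?y"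
    unfolding \<Delta>_eq[OF assms(1)] \<Delta>_eq[OF assms(2)] \<Delta>_eq[OF A.m_closed[OF assms]] m
    using c l r
    by (simp add: a_minus_def T2.l_distr T2.r_distr T2.l_minus T2.r_minus T2.minus_add T2.m_assoc
        T2.smult_mult_left T2.smult_mult_right T2.smult_r_distr T2.smult_r_minus T2.a_ac)
  then show ?thesis
    unfolding L m(3) using c l r assms by (simp add: T2.r_neg \<Delta>_closed)
qed

private lemma map_bilinear:
  "(\<lambda>m n. pure_tensor R T2 A (\<Delta> m) n) \<in> bilinear_maps R A A T3"
  "(\<lambda>m n. pure_tensor R A T2 m (\<Delta> n)) \<in> bilinear_maps R A A (tensor_prod R A T2)"
  by (intro bilinear_mapsI pt3_linear(1) \<Delta>_closed linear_maps_compose[OF comult_of_linear pt3_linear(2)]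
      linear_maps_compose[OF comult_of_linear pure_tensor_linear(1)]
      pure_tensor_linear(2) A.module_axioms T2.module_axioms; assumption)+

text \<open>Both sides are linear in \<open>X\<close>. For X = x \<otimes> y the left-hand side is
  \<Delta> x \<otimes> y, which \<open>pure_tensor_leg12\<close> and \<open>leg_comult_of\<close>
  turn into a product of legs.\<close>

lemma tensor_map_comult_of_left:
  assumes "X \<in> carrier (tensor2 R A)"
  shows "tensor_map R (tensor2 R A) A (comult_of R A l r) (\<lambda>x. x) X
    = (leg13 R A X \<otimes>\<^bsub>tensor3 R A\<^esub> leg12 R A r \<ominus>\<^bsub>tensor3 R A\<^esub> leg12 R A r \<otimes>\<^bsub>tensor3 R A\<^esub> leg23 R A X)
      \<ominus>\<^bsub>tensor3 R A\<^esub> l \<odot>\<^bsub>tensor3 R A\<^esub> leg13 R A X"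
  unfolding tensor_map_def
proof (rule ext3[OF lift_linear[OF map_bilinear(1)] _ _ assms])
  note r3 = linear_mapsD(1)[OF leg_linear(1) r]
  show "(\<lambda>X. (leg13 R A X \<otimes>\<^bsub>T3\<^esub> leg12 R A r \<ominus>\<^bsub>T3\<^esub> leg12 R A r \<otimes>\<^bsub>T3\<^esub> leg23 R A X)
      \<ominus>\<^bsub>T3\<^esub> l \<odot>\<^bsub>T3\<^esub> leg13 R A X) \<in> linear_maps R T2 T3"
    by (intro linear_maps_minus linear_maps_smult T3.module_axioms l leg_linear r3
        linear_maps_compose[OF leg_linear(2) T3.mult_right_linear]
        linear_maps_compose[OF leg_linear(3) T3.mult_left_linear])
  fix x y assume xy: "x \<in> carrier A" "y \<in> carrier A"
  let ?e\<^sub>1 = "pt3 x \<one>\<^bsub>A\<^esub> \<one>\<^bsub>A\<^esub>" and ?e\<^sub>2 = "pt3 \<one>\<^bsub>A\<^esub> x \<one>\<^bsub>A\<^esub>" and ?e\<^sub>3 = "pt3 \<one>\<^bsub>A\<^esub> \<one>\<^bsub>A\<^esub> y" and ?p = "leg12 R A r"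
  have c: "?e\<^sub>1 \<in> carrier T3" "?e\<^sub>2 \<in> carrier T3" "?e\<^sub>3 \<in> carrier T3" "?p \<in> carrier T3"
    using xy r3 by (simp_all add: pure_tensor3_closed)
  have legs: "leg13 R A (pt2 x y) = ?e\<^sub>1 \<otimes>\<^bsub>T3\<^esub> ?e\<^sub>3" "leg23 R A (pt2 x y) = ?e\<^sub>2 \<otimes>\<^bsub>T3\<^esub> ?e\<^sub>3"
    using xy by (simp_all add: leg_pure pure_tensor3_mult)
  have "tensor_lift R T3 (\<lambda>m n. pure_tensor R T2 A (\<Delta> m) n) (pt2 x y) = leg12 R A (\<Delta> x) \<otimes>\<^bsub>T3\<^esub> ?e\<^sub>3"
    using xy by (simp add: lift_pure[OF map_bilinear(1)] pure_tensor_leg12 \<Delta>_closed)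
  also have "\<dots> = ((?e\<^sub>1 \<otimes>\<^bsub>T3\<^esub> ?p \<ominus>\<^bsub>T3\<^esub> ?p \<otimes>\<^bsub>T3\<^esub> ?e\<^sub>2) \<ominus>\<^bsub>T3\<^esub> l \<odot>\<^bsub>T3\<^esub> ?e\<^sub>1) \<otimes>\<^bsub>T3\<^esub> ?e\<^sub>3"
    using xy by (simp add: leg_comult_of leg_pure)
  \<comment> \<open>\<open>?e\<^sub>3\<close> passes \<open>?p\<close> by disjointness of slots; in
    the other two terms it already stands where the legs of x \<otimes> y need it.\<close>
  also have "\<dots> = ((?e\<^sub>1 \<otimes>\<^bsub>T3\<^esub> ?e\<^sub>3) \<otimes>\<^bsub>T3\<^esub> ?p \<ominus>\<^bsub>T3\<^esub> ?p \<otimes>\<^bsub>T3\<^esub> (?e\<^sub>2 \<otimes>\<^bsub>T3\<^esub> ?e\<^sub>3)) \<ominus>\<^bsub>T3\<^esub> l \<odot>\<^bsub>T3\<^esub> (?e\<^sub>1 \<otimes>\<^bsub>T3\<^esub> ?e\<^sub>3)"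
    using c l leg_commute(1)[OF xy(2) r]
    by (simp add: a_minus_def T3.l_distr T3.l_minus T3.m_assoc T3.smult_mult_left)
  finally show "tensor_lift R T3 (\<lambda>m n. pure_tensor R T2 A (\<Delta> m) n) (pt2 x y)
    = (leg13 R A (pt2 x y) \<otimes>\<^bsub>T3\<^esub> ?p \<ominus>\<^bsub>T3\<^esub> ?p \<otimes>\<^bsub>T3\<^esub> leg23 R A (pt2 x y)) \<ominus>\<^bsub>T3\<^esub> l \<odot>\<^bsub>T3\<^esub> leg13 R A (pt2 x y)"
    unfolding legs .
qed

text \<open>Mirror image of \<open>tensor_map_comult_of_left\<close>: on x \<otimes> y it is now
  \<open>x\<close> in the first slot that has to pass the 23 leg of \<open>r\<close>.\<close>

lemma tensor_map_comult_of_right: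
  assumes "X \<in> carrier (tensor2 R A)"
  shows "tensor_assoc R A A A (tensor_map R A (tensor2 R A) (\<lambda>x. x) (comult_of R A l r) X)
    = (leg12 R A X \<otimes>\<^bsub>tensor3 R A\<^esub> leg23 R A r \<ominus>\<^bsub>tensor3 R A\<^esub> leg23 R A r \<otimes>\<^bsub>tensor3 R A\<^esub> leg13 R A X)
      \<ominus>\<^bsub>tensor3 R A\<^esub> l \<odot>\<^bsub>tensor3 R A\<^esub> leg12 R A X"
  unfolding tensor_map_def
proof (rule ext3[OF linear_maps_compose[OF tensor_prod_lift_linear[OF A.module_axioms A.module_axioms
        tensor_prod_module[OF A.module_axioms T2.module_axioms] map_bilinear(2)] tensor_assoc_linear]
      _ _ assms])
  note r3 = linear_mapsD(1)[OF leg_linear(3) r]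
  show "(\<lambda>X. (leg12 R A X \<otimes>\<^bsub>T3\<^esub> leg23 R A r \<ominus>\<^bsub>T3\<^esub> leg23 R A r \<otimes>\<^bsub>T3\<^esub> leg13 R A X)
      \<ominus>\<^bsub>T3\<^esub> l \<odot>\<^bsub>T3\<^esub> leg12 R A X) \<in> linear_maps R T2 T3"
    by (intro linear_maps_minus linear_maps_smult T3.module_axioms l leg_linear r3
        linear_maps_compose[OF leg_linear(1) T3.mult_right_linear]
        linear_maps_compose[OF leg_linear(2) T3.mult_left_linear])
  fix x y assume xy: "x \<in> carrier A" "y \<in> carrier A"
  \<comment> \<open>Here \<open>?e\<^sub>2\<close> carries \<open>y\<close>, because the 12 leg of x
    \<otimes> y has \<open>y\<close> in the second slot.\<close>
  let ?e\<^sub>1 = "pt3 x \<one>\<^bsub>A\<^esub> \<one>\<^bsub>A\<^esub>" and ?e\<^sub>2 = "pt3 \<one>\<^bsub>A\<^esub> y \<one>\<^bsub>A\<^esub>" and ?e\<^sub>3 = "pt3 \<one>\<^bsub>A\<^esub> \<one>\<^bsub>A\<^esub> y" and ?s = "leg23 R A r"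
  have c: "?e\<^sub>1 \<in> carrier T3" "?e\<^sub>2 \<in> carrier T3" "?e\<^sub>3 \<in> carrier T3" "?s \<in> carrier T3"
    using xy r3 by (simp_all add: pure_tensor3_closed)
  have legs: "leg12 R A (pt2 x y) = ?e\<^sub>1 \<otimes>\<^bsub>T3\<^esub> ?e\<^sub>2" "leg13 R A (pt2 x y) = ?e\<^sub>1 \<otimes>\<^bsub>T3\<^esub> ?e\<^sub>3"
    using xy by (simp_all add: leg_pure pure_tensor3_mult)
  let ?L = "tensor_assoc R A A A
    (tensor_lift R (tensor_prod R A T2) (\<lambda>m n. pure_tensor R A T2 m (\<Delta> n)) (pt2 x y))"
  have "?L = ?e\<^sub>1 \<otimes>\<^bsub>T3\<^esub> leg23 R A (\<Delta> y)"
    using xy by (simp add: tensor_lift_pure[OF A.module_axioms A.module_axioms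
        tensor_prod_module[OF A.module_axioms T2.module_axioms] map_bilinear(2)] tensor_assoc_pure \<Delta>_closed)
  also have "\<dots> = ?e\<^sub>1 \<otimes>\<^bsub>T3\<^esub> ((?e\<^sub>2 \<otimes>\<^bsub>T3\<^esub> ?s \<ominus>\<^bsub>T3\<^esub> ?s \<otimes>\<^bsub>T3\<^esub> ?e\<^sub>3) \<ominus>\<^bsub>T3\<^esub> l \<odot>\<^bsub>T3\<^esub> ?e\<^sub>2)"
    using xy by (simp add: leg_comult_of leg_pure)
  \<comment> \<open>The middle term is stated with \<open>?e\<^sub>1\<close> already behind
    \<open>?s\<close>; \<open>leg_commute(2)\<close> moves it back to the front, and the ring laws
    finish.\<close>
  also have "\<dots> = ((?e\<^sub>1 \<otimes>\<^bsub>T3\<^esub> ?e\<^sub>2) \<otimes>\<^bsub>T3\<^esub> ?s \<ominus>\<^bsub>T3\<^esub> (?s \<otimes>\<^bsub>T3\<^esub> ?e\<^sub>1) \<otimes>\<^bsub>T3\<^esub> ?e\<^sub>3) \<ominus>\<^bsub>T3\<^esub> l \<odot>\<^bsub>T3\<^esub> (?e\<^sub>1 \<otimes>\<^bsub>T3\<^esub> ?e\<^sub>2)"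
    unfolding leg_commute(2)[OF xy(1) r] using c l
    by (simp add: a_minus_def T3.r_distr T3.r_minus T3.m_assoc T3.smult_mult_right)
  also have "(?s \<otimes>\<^bsub>T3\<^esub> ?e\<^sub>1) \<otimes>\<^bsub>T3\<^esub> ?e\<^sub>3 = ?s \<otimes>\<^bsub>T3\<^esub> (?e\<^sub>1 \<otimes>\<^bsub>T3\<^esub> ?e\<^sub>3)"
    using c by (simp add: T3.m_assoc)
  finally show "?L = (leg12 R A (pt2 x y) \<otimes>\<^bsub>T3\<^esub> ?s \<ominus>\<^bsub>T3\<^esub> ?s \<otimes>\<^bsub>T3\<^esub> leg13 R A (pt2 x y))
      \<ominus>\<^bsub>T3\<^esub> l \<odot>\<^bsub>T3\<^esub> leg12 R A (pt2 x y)"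
    unfolding legs .
qed

text \<open>After the two preceding formulas, both sides are expressions in the legs of
  \<open>r\<close> and of \<Delta> a, and \<open>leg_comult_of\<close> writes the latter with
  \<open>a\<close> in single slots. So \<open>aybe_identity\<close> applies in A \<otimes> A
  \<otimes> A.\<close>

lemma comult_of_coassociative:
  assumes aybe: "AYBE_solution R A l r" and a: "a \<in> carrier A"
  shows "tensor_map R (tensor2 R A) A (comult_of R A l r) (\<lambda>x. x) (comult_of R A l r a) =
    tensor_assoc R A A A (tensor_map R A (tensor2 R A) (\<lambda>x. x) (comult_of R A l r) (comult_of R A l r a))"
  unfolding tensor_map_comult_of_left[OF \<Delta>_closed[OF a]] tensor_map_comult_of_right[OF \<Delta>_closed[OF a]]
proof (rule T3.aybe_identity)
  \<comment> \<open>The elements \<open>e\<^sub>1\<close>, \<open>e\<^sub>2\<close>,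
    \<open>e\<^sub>3\<close> and \<open>q\<close> do not occur in the conclusion of the identity;
    the memberships shown here and next choose them, as \<open>a\<close> in each of the three slots
    and the 13 leg of \<open>r\<close>.\<close>
  show "pt3 a \<one>\<^bsub>A\<^esub> \<one>\<^bsub>A\<^esub> \<in> carrier T3" "pt3 \<one>\<^bsub>A\<^esub> a \<one>\<^bsub>A\<^esub> \<in> carrier T3" "pt3 \<one>\<^bsub>A\<^esub> \<one>\<^bsub>A\<^esub> a \<in> carrier T3"
    using a by (simp_all add: pure_tensor3_closed)
  show "leg12 R A r \<in> carrier T3" "leg13 R A r \<in> carrier T3" "leg23 R A r \<in> carrier T3"
    using r by (simp_all add: leg_linear[THEN linear_mapsD(1)])
qed (use a l aybe leg_commute[OF a r] in
    \<open>simp_all add: AYBE_solution_def Let_def leg_comult_of leg_pure\<close>)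

end

end

theorem theorem4p6:
  fixes R :: "('k, 'r) ring_scheme"
    and A :: "('k, 'a, 'm) module_scheme"
    and l :: 'k
    and r :: "('k, 'a, 'a) tensor"
  assumes "cring R"
    and "l \<in> carrier R"
    and "unital_algebra R A"
    and "r \<in> carrier (tensor2 R A)"
    and "AYBE_solution R A l r"
  shows "infinitesimal_unitary_bialgebra R A l (comult_of R A l r)"
proof -
  interpret unital_algebra R A by fact
  show ?thesis
    by unfold_locales
      (simp_all add: assms comult_of_linear comult_of_coassociative comult_of_mult)
qed

end
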